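(* Let $\gamma\in(1/2,1)$ and consider the $\mathcal L$-TBRW with $\mathcal L_n=\mathrm{Ber}(n^{-\gamma})$. For every $\varepsilon>0$, $M>0$ and every finite initial condition $(T,x)$, there exist constants $C,C'>0$ depending on $\varepsilon,M,\gamma$ and $|T|$ such that for all $n\ge1$, \[ \mathbb P_{T,x;\mathcal L}\big(\mathrm{diam}(T_n)\ge C n^{\varepsilon}\big)\le \frac{C'}{n^M}. \]
   Context: Tree Builder Random Walk (TBRW). Let $\mathcal L=(\mathcal L_n)_{n\ge1}$ be a sequence of probability laws on $\{0,1,2,\dots\}$ and let $(T_0,x_0)$ be an initial condition: $T_0$ is a finite rooted tree with a single self-loop attached at its root, and $x_0$ is a vertex of $T_0$. Degrees are computed with the self-loop contributing $2$ to the degree of the root; simple random walk on such a tree moves from $v$ along a uniformly chosen edge-end at $v$. Let $(Z_n)_{n\ge1}$ be independent random variables with $Z_n\sim\mathcal L_n$. The TBRW is the process $((T_n,X_n))_{n\ge0}$ with $(T_0,X_0)=(T_0,x_0)$ where, for $n\ge1$, $T_n$ is obtained from $T_{n-1}$ by attaching $Z_n$ new leaves to $X_{n-1}$, and then $X_n$ is obtained by one step of simple random walk on $T_n$ from $X_{n-1}$. Its law is $\mathbb P_{T_0,x_0;\mathcal L}$. $\mathrm{diam}$ is the maximal graph distance between two vertices, $|T|$ the number of vertices. *)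

theory Defs
  imports "HOL-Probability.Probability"
begin

text \<open>Representation of a finite rooted tree (with a self-loop at the root):
  a list ps of parents. The vertices are 0,...,length ps; vertex 0 is the root;
  vertex i+1 has parent ps!i. Every finite rooted tree has such a representation
  (e.g. by labelling vertices in breadth-first order).\<close>

definition valid_tree :: "nat list \<Rightarrow> bool" where
  "valid_tree ps \<longleftrightarrow> (\<forall>i < length ps. ps ! i \<le> i)"

definition tsize :: "nat list \<Rightarrow> nat" where
  "tsize ps = length ps + 1"

definition vertices :: "nat list \<Rightarrow> nat set" where
  "vertices ps = {..<tsize ps}"

definition attach :: "nat list \<Rightarrow> nat \<Rightarrow> nat \<Rightarrow> nat list" where
  "attach ps v k = ps @ replicate k v"

text \<open>Multiset of endpoints of the edge-ends at v; the self-loop at the root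
  contributes two edge-ends, both leading back to the root.\<close>
definition edge_ends :: "nat list \<Rightarrow> nat \<Rightarrow> nat multiset" where
  "edge_ends ps v =
     mset ((if v = 0 then [0, 0] else [ps ! (v - 1)]) @
           [Suc i. i \<leftarrow> [0..<length ps], ps ! i = v])"

definition srw_step :: "nat list \<Rightarrow> nat \<Rightarrow> nat pmf" where
  "srw_step ps v = pmf_of_multiset (edge_ends ps v)"

definition tbrw_step :: "(nat \<Rightarrow> nat pmf) \<Rightarrow> nat \<Rightarrow> nat list \<times> nat \<Rightarrow> (nat list \<times> nat) pmf" where
  "tbrw_step L n s =
     bind_pmf (L n) (\<lambda>z. let ps' = attach (fst s) (snd s) z in
       map_pmf (\<lambda>y. (ps', y)) (srw_step ps' (snd s)))"

primrec tbrw :: "(nat \<Rightarrow> nat pmf) \<Rightarrow> nat list \<Rightarrow> nat \<Rightarrow> nat \<Rightarrow> (nat list \<times> nat) pmf" where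
  "tbrw L ps x 0 = return_pmf (ps, x)"
| "tbrw L ps x (Suc n) = bind_pmf (tbrw L ps x n) (tbrw_step L (Suc n))"

definition ber_law :: "real \<Rightarrow> nat \<Rightarrow> nat pmf" where
  "ber_law \<gamma> n = map_pmf (\<lambda>b. if b then 1 else 0) (bernoulli_pmf (real n powr (- \<gamma>)))"

definition tadj :: "nat list \<Rightarrow> (nat \<times> nat) set" where
  "tadj ps = {(Suc i, ps ! i) | i. i < length ps} \<union> {(ps ! i, Suc i) | i. i < length ps}"

definition tdist :: "nat list \<Rightarrow> nat \<Rightarrow> nat \<Rightarrow> nat" where
  "tdist ps u v = (LEAST k. (u, v) \<in> tadj ps ^^ k)"

definition diam :: "nat list \<Rightarrow> nat" where
  "diam ps = Max {tdist ps u v | u v. u \<in> vertices ps \<and> v \<in> vertices ps}"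

end

theory Submission
  imports Defs "HOL-Real_Asymp.Real_Asymp"
begin

text \<open>
  Let \<open>W = \<Sum>\<^sub>u deg u \<cdot> 2\<^bsup>depth u\<^esup>\<close> and let \<open>V\<close> be the total degree. A new leaf at \<open>x\<close> increases \<open>W\<close> by
  three times the weight of \<open>x\<close>; if the walker were at stationarity this would be \<open>3 W / V\<close> on
  average, so \<open>W\<close> would grow polynomially in \<open>V\<close> and the depth would be logarithmic. The deviation
  from stationarity is absorbed by the solution of a Poisson equation, which is explicit on a tree:
  if \<open>m u x\<close> is the number of common non-root ancestors of \<open>u\<close> and \<open>x\<close>, then
  \<open>g x = \<Sum>\<^sub>u deg u \<cdot> 2\<^bsup>depth u\<^esup> \<cdot> m u x\<close> and \<open>h x = \<Sum>\<^sub>u deg u \<cdot> m u x\<close> have sources at the root in the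
  ratio \<open>W : V\<close>, which cancel in \<open>g - (W / V) h\<close>. Hence, with \<open>c = 6 n\<^bsup>-\<gamma>\<^esup>\<close>, the functional
  \<open>W + c g - c (W / V) h\<close>, divided by a suitable power of \<open>V\<close>, is nearly a supermartingale as long as
  \<open>c V\<close> is small. As \<open>V\<close> is of order \<open>n\<^bsup>1 - \<gamma>\<^esup>\<close>, this is where \<open>\<gamma> > 1/2\<close> enters; the complementary event has
  stretched exponentially small probability, which beats even the trivial bound on \<open>W\<close>.
\<close>

section \<open>Green kernel and Poisson equation on a tree\<close>

text \<open>The path from the root to the given vertex, without the root itself, so that its
  cardinality is the distance to the root. The test \<open>ps ! i \<le> i\<close> makes the
  recursion terminate on arbitrary lists.\<close>

fun ancestors :: "nat list \<Rightarrow> nat \<Rightarrow> nat set" where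
  "ancestors ps 0 = {}"
| "ancestors ps (Suc i) = (if ps ! i \<le> i then insert (Suc i) (ancestors ps (ps ! i)) else {})"

declare ancestors.simps(2)[simp del]

lemma ancestors_subset: "ancestors ps v \<subseteq> {1..v}"
proof (induction ps v rule: ancestors.induct)
  case (2 ps i)
  then show ?case by (cases "ps ! i \<le> i") (auto simp: ancestors.simps(2))
qed simp

lemma finite_ancestors [simp]: "finite (ancestors ps v)"
  by (rule finite_subset[OF ancestors_subset]) simp

lemma ancestors_le: "u \<in> ancestors ps v \<Longrightarrow> u \<le> v"
  and zero_notin_ancestors [simp]: "0 \<notin> ancestors ps v"
  using ancestors_subset[of ps v] by auto

lemma ancestors_Suc:
  "valid_tree ps \<Longrightarrow> i < length ps \<Longrightarrow> ancestors ps (Suc i) = insert (Suc i) (ancestors ps (ps ! i))"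
  by (simp add: ancestors.simps(2) valid_tree_def)

lemma Suc_notin_ancestors_parent:
  "valid_tree ps \<Longrightarrow> i < length ps \<Longrightarrow> Suc i \<notin> ancestors ps (ps ! i)"
  by (auto simp: valid_tree_def dest!: ancestors_le)

definition depth :: "nat list \<Rightarrow> nat \<Rightarrow> nat" where
  "depth ps v = card (ancestors ps v)"

lemma depth_0 [simp]: "depth ps 0 = 0"
  by (simp add: depth_def)

lemma depth_Suc:
  "valid_tree ps \<Longrightarrow> i < length ps \<Longrightarrow> depth ps (Suc i) = Suc (depth ps (ps ! i))"
  by (simp add: depth_def ancestors_Suc Suc_notin_ancestors_parent)

lemma depth_le: "depth ps v \<le> v"
  using card_mono[OF _ ancestors_subset[of ps v]] by (simp add: depth_def)

text \<open>The Green kernel of simple random walk killed at the root, normalised by the degree.\<close>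

definition green :: "nat list \<Rightarrow> nat \<Rightarrow> nat \<Rightarrow> real" where
  "green ps u v = real (card (ancestors ps u \<inter> ancestors ps v))"

lemma green_nonneg [simp]: "0 \<le> green ps u v"
  by (simp add: green_def)

lemma green_0 [simp]: "green ps u 0 = 0" "green ps 0 v = 0"
  by (simp_all add: green_def)

lemma green_le_depth: "green ps u v \<le> depth ps v"
  by (auto simp: green_def depth_def intro!: card_mono)

lemma green_self: "green ps v v = depth ps v"
  by (simp add: green_def depth_def)

lemma green_Suc:
  assumes "valid_tree ps" "i < length ps"
  shows "green ps u (Suc i) = green ps u (ps ! i) + of_bool (Suc i \<in> ancestors ps u)"
  using Suc_notin_ancestors_parent[OF assms]
  by (auto simp: green_def ancestors_Suc[OF assms])

lemma sum_list_children:
  "(\<Sum>y\<leftarrow>[Suc i. i \<leftarrow> [0..<n], P i]. (g y :: real)) = (\<Sum>i<n. of_bool (P i) * g (Suc i))"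
  by (induction n) auto

lemma sum_edge_ends:
  "(\<Sum>y\<in>#edge_ends ps x. (g y :: real)) =
    (if x = 0 then 2 * g 0 else g (ps ! (x - 1))) + (\<Sum>i<length ps. of_bool (ps ! i = x) * g (Suc i))"
  unfolding edge_ends_def mset_map[symmetric] sum_mset_sum_list map_append sum_list_append sum_list_children
  by simp

text \<open>If \<open>x\<close> lies on the path from the root to \<open>u\<close> and
  \<open>x \<noteq> u\<close>, then exactly one child of \<open>x\<close> lies on it too. The
  induction goes along the path: passing from the parent of \<open>u\<close> to \<open>u\<close>
  adds the single child \<open>u\<close> of that parent and moves the endpoint.\<close>

lemma sum_children_ancestors:
  assumes "valid_tree ps" "u \<in> vertices ps"
  shows "(\<Sum>i<length ps. of_bool (ps ! i = x) * (of_bool (Suc i \<in> ancestors ps u) :: real)) =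
    of_bool (x = 0 \<or> x \<in> ancestors ps u) - of_bool (x = u)"
  using assms(2)
proof (induction u rule: less_induct)
  case (less u)
  show ?case
  proof (cases u)
    case 0
    then show ?thesis by auto
  next
    case (Suc j)
    then have j: "j < length ps"
      using less.prems by (simp add: vertices_def tsize_def)
    have "ps ! j \<le> j" using assms(1) j by (simp add: valid_tree_def)
    then have IH: "(\<Sum>i<length ps. of_bool (ps ! i = x) * (of_bool (Suc i \<in> ancestors ps (ps ! j)) :: real)) =
        of_bool (x = 0 \<or> x \<in> ancestors ps (ps ! j)) - of_bool (x = ps ! j)"
      using j Suc by (intro less.IH) (auto simp: vertices_def tsize_def)
    have "(\<Sum>i<length ps. of_bool (ps ! i = x) * (of_bool (Suc i \<in> ancestors ps u) :: real)) =
      (\<Sum>i<length ps. of_bool (ps ! i = x) * (of_bool (Suc i \<in> ancestors ps (ps ! j)) :: real)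
         + of_bool (i = j) * of_bool (ps ! i = x))"
      using Suc_notin_ancestors_parent[OF assms(1) j]
      by (intro sum.cong refl) (auto simp: Suc ancestors_Suc[OF assms(1) j])
    also have "\<dots> = of_bool (x = 0 \<or> x \<in> ancestors ps (ps ! j)) - of_bool (x = ps ! j) + of_bool (ps ! j = x)"
      using j unfolding sum.distrib IH by simp
    also have "\<dots> = of_bool (x = 0 \<or> x \<in> ancestors ps u) - of_bool (x = u)"
      using Suc_notin_ancestors_parent[OF assms(1) j] by (auto simp: Suc ancestors_Suc[OF assms(1) j])
    finally show ?thesis .
  qed
qed

text \<open>A step from \<open>x\<close> to its parent loses one common ancestor if \<open>x\<close>
  is an ancestor of \<open>u\<close>; a step to a child gains one if that child is. The two cancel
  except at \<open>u\<close>, where no child continues the path, and at the root, whose self-loop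
  contributes zero.\<close>

lemma green_laplacian:
  assumes "valid_tree ps" "u \<in> vertices ps" "x \<in> vertices ps"
  shows "(\<Sum>y\<in>#edge_ends ps x. green ps u y - green ps u x) = of_bool (x = 0) - of_bool (u = x)"
proof -
  have children: "(\<Sum>i<length ps. of_bool (ps ! i = x) * (green ps u (Suc i) - green ps u x)) =
      of_bool (x = 0 \<or> x \<in> ancestors ps u) - of_bool (x = u)"
    unfolding sum_children_ancestors[OF assms(1,2), symmetric]
    by (intro sum.cong refl) (auto simp: green_Suc[OF assms(1)])
  show ?thesis
  proof (cases x)
    case 0
    then show ?thesis using children by (auto simp: sum_edge_ends)
  next
    case (Suc j)
    then have j: "j < length ps" using assms(3) by (simp add: vertices_def tsize_def)
    show ?thesis
      using children by (auto simp: sum_edge_ends Suc green_Suc[OF assms(1) j])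
  qed
qed

section \<open>Sums weighted by the degree, and their potentials\<close>

definition degree_sum :: "nat list \<Rightarrow> (nat \<Rightarrow> real) \<Rightarrow> real" where
  "degree_sum ps f = 2 * f 0 + (\<Sum>i<length ps. f (Suc i) + f (ps ! i))"

lemma degree_sum_cong:
  assumes "valid_tree ps" "\<And>u. u \<in> vertices ps \<Longrightarrow> f u = g u"
  shows "degree_sum ps f = degree_sum ps g"
proof -
  have "f (Suc i) + f (ps ! i) = g (Suc i) + g (ps ! i)" if "i < length ps" for i
    using assms that by (auto simp: valid_tree_def vertices_def tsize_def)
  then show ?thesis
    using assms(2)[of 0] by (auto simp: degree_sum_def vertices_def tsize_def intro!: sum.cong)
qed

lemma degree_sum_mono:
  assumes "valid_tree ps" "\<And>u. u \<in> vertices ps \<Longrightarrow> f u \<le> g u"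
  shows "degree_sum ps f \<le> degree_sum ps g"
proof -
  have "f (Suc i) + f (ps ! i) \<le> g (Suc i) + g (ps ! i)" if "i < length ps" for i
    using assms that by (intro add_mono) (auto simp: valid_tree_def vertices_def tsize_def)
  then have "(\<Sum>i<length ps. f (Suc i) + f (ps ! i)) \<le> (\<Sum>i<length ps. g (Suc i) + g (ps ! i))"
    by (intro sum_mono) simp
  then show ?thesis
    using assms(2)[of 0] by (simp add: degree_sum_def vertices_def tsize_def)
qed

lemma degree_sum_const [simp]: "degree_sum ps (\<lambda>_. a) = (2 * real (length ps) + 2) * a"
  by (simp add: degree_sum_def algebra_simps)

lemma degree_sum_scale: "degree_sum ps (\<lambda>u. a * f u) = a * degree_sum ps f"
  by (simp add: degree_sum_def sum_distrib_left algebra_simps)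

lemma degree_sum_add: "degree_sum ps (\<lambda>u. f u + g u) = degree_sum ps f + degree_sum ps g"
  by (simp add: degree_sum_def sum.distrib algebra_simps)

lemma degree_sum_diff: "degree_sum ps (\<lambda>u. f u - g u) = degree_sum ps f - degree_sum ps g"
  by (simp add: degree_sum_def sum.distrib sum_subtractf algebra_simps)

text \<open>Links the edge-by-edge form of \<open>degree_sum\<close> to degrees: a vertex is counted
  once for each of its edge-ends, the self-loop providing two.\<close>

lemma degree_sum_of_bool:
  assumes "x \<in> vertices ps"
  shows "degree_sum ps (\<lambda>u. f u * of_bool (u = x)) = f x * size (edge_ends ps x)"
proof -
  have a: "real (size (edge_ends ps x)) = (if x = 0 then 2 else 1) + (\<Sum>i<length ps. of_bool (ps ! i = x))"
    using sum_edge_ends[of "\<lambda>_. 1" ps x] by simp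
  have b: "(\<Sum>i<length ps. f (Suc i) * of_bool (Suc i = x)) = (if x = 0 then 0 else f x)"
  proof (cases x)
    case (Suc j)
    have "(\<Sum>i<length ps. f (Suc i) * of_bool (Suc i = x)) = (\<Sum>i<length ps. if i = j then f x else 0)"
      by (intro sum.cong) (auto simp: Suc)
    then show ?thesis using assms by (simp add: Suc vertices_def tsize_def)
  qed auto
  have c: "(\<Sum>i<length ps. f (ps ! i) * of_bool (ps ! i = x)) = f x * (\<Sum>i<length ps. of_bool (ps ! i = x))"
    unfolding sum_distrib_left by (intro sum.cong) auto
  show ?thesis
    unfolding degree_sum_def sum.distrib a b c by (auto simp: algebra_simps)
qed

lemma sum_edge_ends_degree_sum:
  "(\<Sum>y\<in>#edge_ends ps x. degree_sum ps (g y)) = degree_sum ps (\<lambda>u. \<Sum>y\<in>#edge_ends ps x. g y u)"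
proof -
  have "(\<Sum>y\<in>#M. degree_sum ps (g y)) = degree_sum ps (\<lambda>u. \<Sum>y\<in>#M. g y u)" for M
    by (induction M) (simp_all add: degree_sum_add degree_sum_def[of _ "\<lambda>_. 0"])
  then show ?thesis .
qed

text \<open>For \<open>f = weight ps\<close> and \<open>f = (\<lambda>_. 1)\<close> these are the
  functions \<open>g\<close> and \<open>h\<close> of the opening text.\<close>

definition potential :: "nat list \<Rightarrow> (nat \<Rightarrow> real) \<Rightarrow> nat \<Rightarrow> real" where
  "potential ps f x = degree_sum ps (\<lambda>u. f u * green ps u x)"

text \<open>The potential solves the Poisson equation with source \<open>f\<close> up to a sink at the root.\<close>

lemma potential_laplacian:
  assumes "valid_tree ps" "x \<in> vertices ps"
  shows "(\<Sum>y\<in>#edge_ends ps x. potential ps f y - potential ps f x) =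
    of_bool (x = 0) * degree_sum ps f - f x * size (edge_ends ps x)"
proof -
  have "(\<Sum>y\<in>#edge_ends ps x. potential ps f y - potential ps f x) =
      degree_sum ps (\<lambda>u. f u * (\<Sum>y\<in>#edge_ends ps x. green ps u y - green ps u x))"
    by (simp add: potential_def degree_sum_diff[symmetric] sum_edge_ends_degree_sum
        sum_mset_distrib_left right_diff_distrib)
  also have "\<dots> = degree_sum ps (\<lambda>u. of_bool (x = 0) * f u - f u * of_bool (u = x))"
    using assms by (intro degree_sum_cong) (simp_all add: green_laplacian algebra_simps)
  finally show ?thesis
    by (simp add: degree_sum_diff degree_sum_scale degree_sum_of_bool assms)
qed

section \<open>Attaching a leaf\<close>

lemma valid_tree_snoc: "valid_tree ps \<Longrightarrow> x \<in> vertices ps \<Longrightarrow> valid_tree (ps @ [x])"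
  by (auto simp: valid_tree_def vertices_def tsize_def nth_append)

lemma vertices_snoc: "vertices (ps @ [x]) = insert (Suc (length ps)) (vertices ps)"
  by (auto simp: vertices_def tsize_def)

text \<open>The new leaf has the largest label, so no path from the root to an old vertex passes
  through it.\<close>

lemma ancestors_snoc:
  assumes "valid_tree ps" "u \<in> vertices ps"
  shows "ancestors (ps @ [x]) u = ancestors ps u"
  using assms(2)
proof (induction u rule: less_induct)
  case (less u)
  show ?case
  proof (cases u)
    case (Suc j)
    then have j: "j < length ps" using less.prems by (simp add: vertices_def tsize_def)
    moreover have "ps ! j \<le> j" using assms(1) j by (simp add: valid_tree_def)
    ultimately have "ancestors (ps @ [x]) (ps ! j) = ancestors ps (ps ! j)"
      using Suc by (intro less.IH) (auto simp: vertices_def tsize_def)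
    then show ?thesis by (simp add: Suc ancestors.simps(2) nth_append j)
  qed simp
qed

lemma ancestors_new_leaf:
  assumes "valid_tree ps" "x \<in> vertices ps"
  shows "ancestors (ps @ [x]) (Suc (length ps)) = insert (Suc (length ps)) (ancestors ps x)"
  using ancestors_Suc[OF valid_tree_snoc[OF assms], of "length ps"] ancestors_snoc[OF assms]
  by simp

lemma depth_snoc: "valid_tree ps \<Longrightarrow> u \<in> vertices ps \<Longrightarrow> depth (ps @ [x]) u = depth ps u"
  by (simp add: depth_def ancestors_snoc)

lemma depth_new_leaf:
  "valid_tree ps \<Longrightarrow> x \<in> vertices ps \<Longrightarrow> depth (ps @ [x]) (Suc (length ps)) = Suc (depth ps x)"
  using depth_Suc[OF valid_tree_snoc, of ps x "length ps"] by (simp add: depth_snoc)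

lemma green_snoc:
  "valid_tree ps \<Longrightarrow> u \<in> vertices ps \<Longrightarrow> v \<in> vertices ps \<Longrightarrow> green (ps @ [x]) u v = green ps u v"
  by (simp add: green_def ancestors_snoc)

lemma green_new_leaf:
  assumes "valid_tree ps" "x \<in> vertices ps"
  shows "green (ps @ [x]) (Suc (length ps)) x = depth ps x"
proof -
  have "insert (Suc (length ps)) (ancestors ps x) \<inter> ancestors ps x = ancestors ps x" by auto
  then show ?thesis
    by (simp add: green_def ancestors_new_leaf ancestors_snoc assms depth_def)
qed

lemma degree_sum_snoc:
  assumes "valid_tree ps" "\<And>u. u \<in> vertices ps \<Longrightarrow> f' u = f u"
  shows "degree_sum (ps @ [x]) f' = degree_sum ps f + f' (Suc (length ps)) + f' x"
proof -
  have "degree_sum (ps @ [x]) f' = degree_sum ps f' + f' (Suc (length ps)) + f' x"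
    by (simp add: degree_sum_def nth_append)
  also have "degree_sum ps f' = degree_sum ps f"
    using assms by (rule degree_sum_cong)
  finally show ?thesis .
qed

text \<open>The new edge has one end at the leaf and one at \<open>x\<close>, and both vertices
  share with \<open>x\<close> all its \<open>depth ps x\<close> non-root ancestors. The source may
  depend on the tree, as \<open>weight\<close> does, provided that it is unchanged on old
  vertices.\<close>

lemma potential_snoc:
  assumes "valid_tree ps" "x \<in> vertices ps" "\<And>u. u \<in> vertices ps \<Longrightarrow> f' u = f u"
  shows "potential (ps @ [x]) f' x = potential ps f x + (f' (Suc (length ps)) + f' x) * depth ps x"
  using assms unfolding potential_def
  by (subst degree_sum_snoc[where f = "\<lambda>u. f u * green ps u x"])
    (simp_all add: green_snoc green_new_leaf green_self depth_snoc algebra_simps)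

section \<open>Weights exponential in the depth\<close>

definition weight :: "nat list \<Rightarrow> nat \<Rightarrow> real" where
  "weight ps v = 2 ^ depth ps v"

abbreviation weight_sum :: "nat list \<Rightarrow> real" where
  "weight_sum ps \<equiv> degree_sum ps (weight ps)"

lemma weight_ge_1: "1 \<le> weight ps v"
  by (simp add: weight_def)

lemma weight_snoc: "valid_tree ps \<Longrightarrow> u \<in> vertices ps \<Longrightarrow> weight (ps @ [x]) u = weight ps u"
  by (simp add: weight_def depth_snoc)

lemma weight_new_leaf:
  "valid_tree ps \<Longrightarrow> x \<in> vertices ps \<Longrightarrow> weight (ps @ [x]) (Suc (length ps)) = 2 * weight ps x"
  by (simp add: weight_def depth_new_leaf)

text \<open>The leaf is one level deeper and contributes \<open>2 * weight ps x\<close>; the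
  additional edge-end at \<open>x\<close> contributes \<open>weight ps x\<close>.\<close>

lemma weight_sum_snoc:
  assumes "valid_tree ps" "x \<in> vertices ps"
  shows "weight_sum (ps @ [x]) = weight_sum ps + 3 * weight ps x"
  using degree_sum_snoc[of ps "weight (ps @ [x])" "weight ps" x] assms
  by (simp add: weight_snoc weight_new_leaf)

lemma vertices_length: "v \<in> vertices ps \<longleftrightarrow> v \<le> length ps"
  by (auto simp: vertices_def tsize_def)

lemma depth_le_length: "v \<in> vertices ps \<Longrightarrow> depth ps v \<le> length ps"
  using depth_le[of ps v] by (simp add: vertices_length)

lemma weight_sum_ge:
  assumes "valid_tree ps"
  shows "2 * real (length ps) + 2 \<le> weight_sum ps"
  using degree_sum_mono[OF assms, of "\<lambda>_. 1" "weight ps"] weight_ge_1 by simp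

text \<open>Trivial bound from depths being at most \<open>length ps\<close>. It serves for small
  trees in \<open>gain_inequality\<close> and, through \<open>lyap_le\<close>, on the exceptional
  event.\<close>

lemma weight_sum_le:
  assumes "valid_tree ps"
  shows "weight_sum ps \<le> 2 * 4 ^ length ps"
proof -
  have "weight_sum ps \<le> degree_sum ps (\<lambda>_. 2 ^ length ps)"
    using assms by (intro degree_sum_mono) (auto simp: weight_def depth_le_length)
  also have "\<dots> = 2 * (real (length ps) + 1) * 2 ^ length ps" by simp
  also have "real (length ps) + 1 \<le> 2 ^ length ps"
    by (induction ps) auto
  also have "2 * (2::real) ^ length ps * 2 ^ length ps = 2 * 4 ^ length ps"
    by (simp add: power_mult_distrib[symmetric])
  finally show ?thesis by simp
qed

lemma weight_le_weight_sum:
  assumes "v \<in> vertices ps"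
  shows "weight ps v \<le> weight_sum ps"
proof (cases v)
  case 0
  have "0 \<le> (\<Sum>i<length ps. weight ps (Suc i) + weight ps (ps ! i))"
    by (intro sum_nonneg) (simp add: weight_def)
  then show ?thesis by (simp add: degree_sum_def 0 weight_def)
next
  case (Suc j)
  have "weight ps (Suc j) \<le> weight ps (Suc j) + weight ps (ps ! j)" by (simp add: weight_def)
  also have "\<dots> \<le> (\<Sum>i<length ps. weight ps (Suc i) + weight ps (ps ! i))"
    using assms by (intro member_le_sum) (auto simp: Suc vertices_length weight_def)
  also have "\<dots> \<le> weight_sum ps" by (simp add: degree_sum_def weight_def)
  finally show ?thesis by (simp add: Suc)
qed

lemma potential_nonneg:
  assumes "valid_tree ps" "\<And>u. 0 \<le> f u"
  shows "0 \<le> potential ps f x"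
  unfolding potential_def
  using degree_sum_mono[OF assms(1), of "\<lambda>_. 0" "\<lambda>u. f u * green ps u x"] assms(2) by simp

lemma potential_le:
  assumes "valid_tree ps" "\<And>u. 0 \<le> f u"
  shows "potential ps f x \<le> degree_sum ps f * depth ps x"
proof -
  have "potential ps f x \<le> degree_sum ps (\<lambda>u. depth ps x * f u)"
    unfolding potential_def using assms
    by (intro degree_sum_mono) (auto simp: mult.commute[of "real (depth ps x)"] green_le_depth intro!: mult_left_mono)
  then show ?thesis unfolding degree_sum_scale by (simp only: mult.commute)
qed

section \<open>One-step drift of the corrected weight\<close>

text \<open>Dividing by the binomial coefficient, a polynomial in the number of edges, compensates the
  drift \<open>3 W / V\<close>; the additive constant makes this work for small trees too.\<close>

definition lyap :: "real \<Rightarrow> nat list \<Rightarrow> nat \<Rightarrow> real" where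
  "lyap c ps x = (weight_sum ps + 4 ^ 13 + c * potential ps (weight ps) x
     - c * (weight_sum ps / (2 * real (length ps) + 2)) * potential ps (\<lambda>_. 1) x)
     / ((length ps + 13) choose 13)"

lemma size_edge_ends_pos: "0 < size (edge_ends ps x)"
  by (simp add: edge_ends_def)

text \<open>By \<open>potential_laplacian\<close> the two potentials have root terms
  \<open>W\<close> and \<open>V\<close>, which the coefficient \<open>W / V\<close> cancels. What
  remains of the average change is \<open>c * (W / V - weight ps x)\<close> in the numerator: the
  walker's weight is replaced by its stationary mean.\<close>

lemma lyap_average:
  assumes "valid_tree ps" "x \<in> vertices ps"
  shows "(\<Sum>y\<in>#edge_ends ps x. lyap c ps y) / size (edge_ends ps x) =
    (weight_sum ps + 4 ^ 13 + c * (potential ps (weight ps) x - weight ps x)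
     - c * (weight_sum ps / (2 * real (length ps) + 2)) * (potential ps (\<lambda>_. 1) x - 1))
     / ((length ps + 13) choose 13)"
proof -
  define s where "s = real (size (edge_ends ps x))"
  define W where "W = weight_sum ps"
  define V where "V = 2 * real (length ps) + 2"
  define B where "B = real ((length ps + 13) choose 13)"
  define g where "g = potential ps (weight ps)"
  define h where "h = potential ps (\<lambda>_. 1)"
  have pos: "s > 0" "V > 0" "B > 0"
    using size_edge_ends_pos[of ps x] by (auto simp: s_def V_def B_def zero_less_binomial_iff)
  have lyap: "lyap c ps y = (W + 4 ^ 13 + c * g y - c * (W / V) * h y) / B" for y
    by (simp only: lyap_def W_def V_def B_def g_def h_def)
  have g: "(\<Sum>y\<in>#edge_ends ps x. g y - g x) = of_bool (x = 0) * W - weight ps x * s"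
    unfolding g_def s_def W_def by (rule potential_laplacian[OF assms])
  have h: "(\<Sum>y\<in>#edge_ends ps x. h y - h x) = of_bool (x = 0) * V - s"
    unfolding h_def s_def V_def using potential_laplacian[OF assms, of "\<lambda>_. 1"] by simp
  have lin: "(\<Sum>y\<in>#M. lyap c ps y - lyap c ps x) =
     (c * (\<Sum>y\<in>#M. g y - g x) - c * (W / V) * (\<Sum>y\<in>#M. h y - h x)) / B" for M
    by (induction M) (simp_all add: lyap diff_divide_distrib add_divide_distrib algebra_simps)
  have decomp: "(\<Sum>y\<in>#M. lyap c ps y) = size M * a + (\<Sum>y\<in>#M. lyap c ps y - a)" for a :: real and M
    by (induction M) (simp_all add: algebra_simps)
  have "(\<Sum>y\<in>#edge_ends ps x. lyap c ps y) =
      s * lyap c ps x + (\<Sum>y\<in>#edge_ends ps x. lyap c ps y - lyap c ps x)"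
    using decomp[where a = "lyap c ps x"] by (simp add: s_def)
  also have "\<dots> = s * (lyap c ps x + (- c * weight ps x + c * (W / V)) / B)"
    unfolding lin g h using pos by (simp add: field_simps)
  finally have total: "(\<Sum>y\<in>#edge_ends ps x. lyap c ps y) =
      s * (lyap c ps x + (- c * weight ps x + c * (W / V)) / B)" .
  have "(\<Sum>y\<in>#edge_ends ps x. lyap c ps y) / s = lyap c ps x + (- c * weight ps x + c * (W / V)) / B"
    unfolding total using pos by simp
  also have "\<dots> = (W + 4 ^ 13 + c * (g x - weight ps x) - c * (W / V) * (h x - 1)) / B"
    by (simp add: lyap diff_divide_distrib add_divide_distrib algebra_simps)
  finally have "(\<Sum>y\<in>#edge_ends ps x. lyap c ps y) / s =
      (W + 4 ^ 13 + c * (g x - weight ps x) - c * (W / V) * (h x - 1)) / B" .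
  then show ?thesis
    by (simp only: s_def W_def V_def B_def g_def h_def)
qed

text \<open>Numerical core of the drift bound: \<open>W\<close> is the weight sum, \<open>V\<close>
  the total degree, \<open>f\<close> and \<open>d\<close> are the weight and depth of the walker's
  vertex, \<open>g\<close> and \<open>h\<close> the potentials, \<open>H\<close> the additive
  constant, \<open>p\<close> the probability of a leaf and \<open>r\<close> the ratio of the
  normalisations. The term \<open>- c * f\<close> of the Poisson correction absorbs the growth due
  to the leaf; the price \<open>c * W / V\<close> is paid by \<open>gain\<close>.\<close>

lemma drift_algebra:
  fixes W H f g h V d p c r :: real
  assumes "c = 6 * p" "0 \<le> p" "c * V \<le> 1/4" "2 \<le> V" "0 \<le> d" "d \<le> V / 2"
    and "0 \<le> h" "h \<le> V * d" "0 \<le> f" "0 \<le> g" "0 \<le> W" "0 \<le> H" "0 \<le> r" "r \<le> 1"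
    and gain: "13 * W / V \<le> (1 - r) * (W + H)"
  shows "(1 - p) * (W + H + c * (g - f) - c * (W / V) * (h - 1))
    + p * r * (W + 3 * f + H + c * (g + 3 * f * d - f) - c * ((W + 3 * f) / (V + 2)) * (h + 2 * d - 1))
    \<le> W + H + c * g - c * (W / V) * h"
proof -
  define B where "B = W + H + c * g - c * (W / V) * h"
  define q where "q = W / V"
  have q: "0 \<le> q" "W = q * V" using assms by (auto simp: q_def)
  have c0: "0 \<le> c" using assms by simp
  have c1: "c \<le> 1/8" using mult_left_mono[OF assms(4) c0] assms(3) by linarith
  have cd: "c * d \<le> 1/8" using mult_left_mono[OF assms(6) c0] assms(3) by simp
  \<comment> \<open>The subtracted correction is at most \<open>W / 8\<close>, so the numerator
    \<open>B\<close> stays above \<open>(W + H) / 2\<close>.\<close>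
  have "c * (W / V) * h \<le> c * (W / V) * (V * d)"
    using assms c0 by (intro mult_left_mono) auto
  also have "\<dots> = (c * d) * W" using assms by simp
  also have "\<dots> \<le> 1/8 * W" using cd assms by (intro mult_right_mono) auto
  finally have "c * (W / V) * h \<le> 1/8 * W" .
  moreover have "0 \<le> c * g" using assms c0 by simp
  moreover have "(W + H) / 2 \<le> W + H + a - b" if "0 \<le> a" "b \<le> 1/8 * W" for a b :: real
    using that assms by simp
  ultimately have B: "(W + H) / 2 \<le> B"
    unfolding B_def by blast
  \<comment> \<open>Cost of replacing the denominator \<open>V\<close> by \<open>V + 2\<close> after
    the leaf is attached.\<close>
  have h2: "q * h * 2 / (V + 2) \<le> 2 * d * q"
  proof -
    have "q * h * 2 / (V + 2) \<le> q * h * 2 / V"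
      using assms q by (intro divide_left_mono) auto
    also have "\<dots> = (2 * q) * (h / V)" by simp
    also have "\<dots> \<le> (2 * q) * d"
      using assms q by (intro mult_left_mono) (auto simp: field_simps)
    finally show ?thesis by (simp add: mult_ac)
  qed
  have W2: "W / (V + 2) = q - 2 * q / (V + 2)"
    using assms q(1) by (simp add: q(2) field_simps)
  have f2: "f / (V + 2) \<le> f / 4"
    using assms by (intro divide_left_mono) auto
  have "((W + 3 * f) / (V + 2)) * (h + 2 * d - 1) \<ge> (W / (V + 2)) * h - (W + 3 * f) / (V + 2)"
  proof -
    have "(W + 3 * f) / (V + 2) * (h + 2 * d) \<ge> (W / (V + 2)) * h"
      using assms by (intro mult_mono divide_right_mono) auto
    then show ?thesis unfolding right_diff_distrib by simp
  qed
  moreover have "(W / (V + 2)) * h = q * h - q * h * 2 / (V + 2)"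
    unfolding W2 by (simp add: algebra_simps)
  moreover have "(W + 3 * f) / (V + 2) \<le> q + 3 * f / 4"
  proof -
    have "(W + 3 * f) / (V + 2) = W / (V + 2) + 3 * (f / (V + 2))"
      by (simp add: add_divide_distrib)
    moreover have "0 \<le> 2 * q / (V + 2)" using q assms by simp
    ultimately show ?thesis using f2 W2 by linarith
  qed
  ultimately have "((W + 3 * f) / (V + 2)) * (h + 2 * d - 1) \<ge> q * h - 2 * d * q - (q + 3 * f / 4)"
    using h2 by linarith
  then have "c * ((W + 3 * f) / (V + 2) * (h + 2 * d - 1)) \<ge> c * (q * h - 2 * d * q - (q + 3 * f / 4))"
    using c0 by (intro mult_left_mono)
  moreover have "c * d * q \<le> 1/8 * q" "c * d * f \<le> 1/8 * f" "c * f \<le> 1/8 * f"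
    using mult_right_mono[OF cd q(1)] mult_right_mono[OF cd \<open>0 \<le> f\<close>] mult_right_mono[OF c1 \<open>0 \<le> f\<close>] .
  \<comment> \<open>The terms in \<open>f\<close> add up to \<open>3 + 3/8 + 3/32 < 4\<close>, and
    \<open>q / 4\<close> is the bound for \<open>2 * c * d * q\<close>.\<close>
  ultimately have "W + 3 * f + H + c * (g + 3 * f * d - f) - c * ((W + 3 * f) / (V + 2)) * (h + 2 * d - 1)
      \<le> B + 4 * f - c * f + c * q + q / 4"
    unfolding B_def q_def[symmetric] using assms by (simp add: algebra_simps)
  then have "p * r * (W + 3 * f + H + c * (g + 3 * f * d - f) - c * ((W + 3 * f) / (V + 2)) * (h + 2 * d - 1))
      \<le> p * r * (B + 4 * f - c * f + c * q + q / 4)"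
    using assms by (intro mult_left_mono) auto
  also have "\<dots> = p * r * B + p * r * (4 * f - c * f) + p * r * (c * q + q / 4)"
    by (simp add: algebra_simps)
  \<comment> \<open>The factor \<open>r\<close> is dropped on the nonnegative error terms and kept
    on \<open>B\<close>, where it yields the gain.\<close>
  also have "\<dots> \<le> p * r * B + p * (4 * f - c * f) + p * (c * q + q / 4)"
  proof -
    have "p * r \<le> p" using assms by (simp add: mult_left_le)
    moreover have "0 \<le> 4 * f - c * f" using \<open>c * f \<le> 1/8 * f\<close> \<open>0 \<le> f\<close> by linarith
    moreover have "0 \<le> c * q + q / 4" using q c0 by simp
    ultimately show ?thesis
      by (meson add_left_mono add_mono mult_right_mono)
  qed
  finally have 1: "p * r * (W + 3 * f + H + c * (g + 3 * f * d - f) - c * ((W + 3 * f) / (V + 2)) * (h + 2 * d - 1))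
    \<le> p * r * B + p * (4 * f - c * f) + p * (c * q + q / 4)" .
  have 2: "(1 - p) * (W + H + c * (g - f) - c * (W / V) * (h - 1)) = (1 - p) * (B - c * f + c * q)"
    unfolding B_def q_def[symmetric] by (simp add: algebra_simps)
  have "p * (13/2 * q) \<le> p * ((1 - r) * B)"
  proof (intro mult_left_mono)
    have "13 * q \<le> (1 - r) * (W + H)" using gain by (simp add: q_def)
    also have "\<dots> \<le> (1 - r) * (2 * B)" using B assms by (intro mult_left_mono) auto
    finally show "13/2 * q \<le> (1 - r) * B" by simp
  qed (use assms in auto)
  moreover have "0 \<le> p * f" "0 \<le> p * q" using assms q by auto
  \<comment> \<open>With \<open>c = 6 * p\<close>, the loss \<open>6 * p * f\<close> exceeds
    \<open>4 * p * f\<close>, and \<open>6 * p * q + p * q / 4\<close> is below the gain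
    \<open>13/2 * p * q\<close>.\<close>
  ultimately have "(1 - p) * (B - c * f + c * q) + (p * r * B + p * (4 * f - c * f) + p * (c * q + q / 4)) \<le> B"
    unfolding \<open>c = 6 * p\<close> by (simp add: algebra_simps)
  then show ?thesis using 1 2 unfolding B_def by linarith
qed

text \<open>Attaching a leaf multiplies the reciprocal of the binomial coefficient by
  \<open>(L + 1) / (L + 14) = 1 - 13 / (L + 14)\<close>. For \<open>L \<ge> 12\<close> this relative
  loss is at least \<open>13 / V\<close>, where \<open>V = 2 * L + 2\<close>.\<close>

lemma binomial_ratio:
  "real (L + 1) * real ((L + 14) choose 13) = real (L + 14) * real ((L + 13) choose 13)"
proof -
  have "(L + 1) * ((L + 14) choose 13) = (L + 14) * ((L + 13) choose 13)"
  proof -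
    have "L + 14 - 13 = L + 1" "L + 14 - 1 = L + 13" by simp_all
    then show ?thesis using binomial_absorb_comp[of "L + 14" 13] by (simp only:)
  qed
  then show ?thesis by (metis of_nat_mult)
qed

text \<open>For \<open>L \<ge> 12\<close> the gain comes from the binomial normalisation alone; for smaller trees the
  constant \<open>4 ^ 13\<close> dominates the weight.\<close>

lemma gain_inequality:
  assumes "valid_tree ps"
  defines "L \<equiv> real (length ps)"
  shows "13 * weight_sum ps / (2 * L + 2) \<le> (1 - (L + 1) / (L + 14)) * (weight_sum ps + 4 ^ 13)"
proof -
  define W where "W = weight_sum ps"
  have L: "0 \<le> L" by (simp add: L_def)
  have W: "0 \<le> W" using weight_sum_ge[OF assms(1)] by (simp add: W_def)
  have "W * (L + 14) \<le> (W + 4 ^ 13) * (2 * L + 2)"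
  proof (cases "12 \<le> length ps")
    case True
    then have "12 \<le> L" by (simp add: L_def)
    then have "W * (L + 14) \<le> W * (2 * L + 2)" using W by (intro mult_left_mono) auto
    also have "\<dots> \<le> (W + 4 ^ 13) * (2 * L + 2)" using L by (intro mult_right_mono) auto
    finally show ?thesis .
  next
    case False
    have "W \<le> 2 * 4 ^ length ps" unfolding W_def by (rule weight_sum_le[OF assms(1)])
    also have "\<dots> \<le> 2 * 4 ^ 11" using False by (intro mult_left_mono power_increasing) auto
    finally have "12 * W \<le> 2 * 4 ^ 13" by simp
    moreover have "0 \<le> W * L" "0 \<le> L" using W L by auto
    ultimately show ?thesis by (simp add: algebra_simps)
  qed
  then have "13 * (W * (L + 14)) \<le> 13 * ((W + 4 ^ 13) * (2 * L + 2))" by simp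
  moreover have "1 - (L + 1) / (L + 14) = 13 / (L + 14)" using L by (simp add: field_simps)
  ultimately show ?thesis
    unfolding W_def[symmetric] using L by (simp add: field_simps)
qed

text \<open>Supermartingale property for a fixed coefficient \<open>c\<close>: the two averages are
  those without and with a new leaf. Both are evaluated by \<open>lyap_average\<close>, the second
  one on the enlarged tree, and then compared by \<open>drift_algebra\<close>.\<close>

lemma lyap_step:
  assumes "valid_tree ps" "x \<in> vertices ps" "0 \<le> p" "c = 6 * p" "p \<le> 1"
    and small: "c * (2 * real (length ps) + 2) \<le> 1/4"
  shows "(1 - p) * ((\<Sum>y\<in>#edge_ends ps x. lyap c ps y) / size (edge_ends ps x))
    + p * ((\<Sum>y\<in>#edge_ends (ps @ [x]) x. lyap c (ps @ [x]) y) / size (edge_ends (ps @ [x]) x))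
    \<le> lyap c ps x"
proof -
  define L where "L = real (length ps)"
  define V where "V = 2 * L + 2"
  define W where "W = weight_sum ps"
  define f where "f = weight ps x"
  define g where "g = potential ps (weight ps) x"
  define h where "h = potential ps (\<lambda>_. 1) x"
  define d where "d = real (depth ps x)"
  define B where "B = real ((length ps + 13) choose 13)"
  define r where "r = (L + 1) / (L + 14)"
  have L: "0 \<le> L" by (simp add: L_def)
  have x': "x \<in> vertices (ps @ [x])" using assms by (simp add: vertices_snoc)
  have Bpos: "B > 0" by (simp add: B_def zero_less_binomial_iff)
  have f0: "0 \<le> f" using weight_ge_1[of ps x] by (simp add: f_def)
  have "real ((length ps + 14) choose 13) = B * ((L + 14) / (L + 1))"
    using binomial_ratio[of "length ps"] L by (simp add: B_def L_def field_simps)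
  then have B': "u / real ((length ps + 14) choose 13) = r * u / B" for u
    using L by (simp add: r_def mult_ac)
  have a0: "(\<Sum>y\<in>#edge_ends ps x. lyap c ps y) / size (edge_ends ps x) =
      (W + 4 ^ 13 + c * (g - f) - c * (W / V) * (h - 1)) / B"
    unfolding lyap_average[OF assms(1,2)] by (simp only: W_def V_def B_def g_def h_def f_def L_def)
  have g': "potential (ps @ [x]) (weight (ps @ [x])) x = g + 3 * f * d"
    using potential_snoc[of ps x "weight (ps @ [x])" "weight ps"] assms
    by (simp add: weight_snoc weight_new_leaf g_def f_def d_def)
  have h': "potential (ps @ [x]) (\<lambda>_. 1) x = h + 2 * d"
    using potential_snoc[of ps x "\<lambda>_. 1" "\<lambda>_. 1"] assms by (simp add: h_def d_def)
  have W': "weight_sum (ps @ [x]) = W + 3 * f"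
    using weight_sum_snoc[of ps x] assms by (simp add: W_def f_def)
  have V': "2 * real (length (ps @ [x])) + 2 = V + 2" by (simp add: V_def L_def)
  have l': "length (ps @ [x]) + 13 = length ps + 14" by simp
  have f': "weight (ps @ [x]) x = f" using assms by (simp add: weight_snoc f_def)
  have a1: "(\<Sum>y\<in>#edge_ends (ps @ [x]) x. lyap c (ps @ [x]) y) / size (edge_ends (ps @ [x]) x) =
      r * (W + 3 * f + 4 ^ 13 + c * (g + 3 * f * d - f) - c * ((W + 3 * f) / (V + 2)) * (h + 2 * d - 1)) / B"
    unfolding lyap_average[OF valid_tree_snoc[OF assms(1,2)] x'] g' h' W' V' l' f' B' ..
  have "(1 - p) * (W + 4 ^ 13 + c * (g - f) - c * (W / V) * (h - 1))
    + p * r * (W + 3 * f + 4 ^ 13 + c * (g + 3 * f * d - f) - c * ((W + 3 * f) / (V + 2)) * (h + 2 * d - 1))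
    \<le> W + 4 ^ 13 + c * g - c * (W / V) * h"
  proof (rule drift_algebra)
    show "d \<le> V / 2" using depth_le_length[OF assms(2)] by (simp add: d_def V_def L_def)
    show "h \<le> V * d"
      using potential_le[OF assms(1), of "\<lambda>_. 1" x] by (simp add: h_def V_def d_def L_def)
    show "0 \<le> h" using potential_nonneg[OF assms(1)] by (simp add: h_def)
    show "0 \<le> g" using potential_nonneg[OF assms(1)] by (simp add: g_def weight_def)
    show "0 \<le> W" using weight_sum_ge[OF assms(1)] by (simp add: W_def)
    show "13 * W / V \<le> (1 - r) * (W + 4 ^ 13)"
      using gain_inequality[OF assms(1)] by (simp only: W_def V_def L_def r_def)
  qed (use assms L f0 in \<open>auto simp: V_def L_def d_def r_def\<close>)
  then have "((1 - p) * (W + 4 ^ 13 + c * (g - f) - c * (W / V) * (h - 1))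
    + p * r * (W + 3 * f + 4 ^ 13 + c * (g + 3 * f * d - f) - c * ((W + 3 * f) / (V + 2)) * (h + 2 * d - 1))) / B
    \<le> (W + 4 ^ 13 + c * g - c * (W / V) * h) / B"
    using Bpos by (intro divide_right_mono) auto
  then have "(1 - p) * ((W + 4 ^ 13 + c * (g - f) - c * (W / V) * (h - 1)) / B)
    + p * (r * (W + 3 * f + 4 ^ 13 + c * (g + 3 * f * d - f) - c * ((W + 3 * f) / (V + 2)) * (h + 2 * d - 1)) / B)
    \<le> (W + 4 ^ 13 + c * g - c * (W / V) * h) / B"
    by (simp only: add_divide_distrib times_divide_eq_right mult.assoc)
  then show ?thesis
    unfolding a0 a1 by (simp only: lyap_def W_def V_def B_def g_def h_def L_def)
qed

text \<open>Since \<open>h \<le> V * d\<close> and \<open>d \<le> V / 2\<close>, the subtracted term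
  is at most \<open>c * d * W \<le> W / 2\<close>. The bound \<open>1\<close> in the hypothesis,
  weaker than the \<open>1/4\<close> of \<open>lyap_step\<close>, leaves room for one more
  leaf.\<close>

lemma lyap_ge:
  assumes "valid_tree ps" "x \<in> vertices ps" "0 \<le> c" "c * (2 * real (length ps) + 2) \<le> 1"
  shows "(weight_sum ps + 4 ^ 13) / (2 * real ((length ps + 13) choose 13)) \<le> lyap c ps x"
proof -
  define V where "V = 2 * real (length ps) + 2"
  define W where "W = weight_sum ps"
  have V: "V > 0" by (simp add: V_def)
  have W: "0 \<le> W" using weight_sum_ge[OF assms(1)] by (simp add: W_def)
  have "c * depth ps x \<le> c * (V / 2)"
    using assms depth_le_length[OF assms(2)] by (intro mult_left_mono) (auto simp: V_def)
  also have "\<dots> \<le> 1 / 2" using assms by (simp add: V_def)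
  finally have cd: "c * depth ps x \<le> 1 / 2" .
  have "c * (W / V) * potential ps (\<lambda>_. 1) x \<le> c * (W / V) * (V * depth ps x)"
    using potential_le[OF assms(1), of "\<lambda>_. 1" x] W V assms
    by (intro mult_left_mono) (auto simp: V_def)
  also have "\<dots> = (c * depth ps x) * W" using V by simp
  also have "\<dots> \<le> 1 / 2 * W" using cd W by (intro mult_right_mono) auto
  finally have h: "c * (W / V) * potential ps (\<lambda>_. 1) x \<le> 1 / 2 * W" .
  have "(W + 4 ^ 13) / 2 \<le> W + 4 ^ 13 + c * potential ps (weight ps) x
     - c * (W / V) * potential ps (\<lambda>_. 1) x"
  proof -
    have "(W + 4 ^ 13) / 2 \<le> W + 4 ^ 13 + a - b" if "0 \<le> a" "b \<le> 1 / 2 * W" for a b :: real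
      using that by simp
    moreover have "0 \<le> c * potential ps (weight ps) x"
      using potential_nonneg[OF assms(1), of "weight ps" x] assms(3) by (simp add: weight_def)
    ultimately show ?thesis using h by blast
  qed
  then have "(W + 4 ^ 13) / 2 / real ((length ps + 13) choose 13) \<le> lyap c ps x"
    unfolding lyap_def W_def[symmetric] V_def[symmetric] by (intro divide_right_mono) auto
  then show ?thesis by (simp add: W_def divide_divide_eq_left)
qed

text \<open>Crude bound from \<open>c * g \<le> c * d * W \<le> W\<close>, meant for steps starting
  from a tree that is too large for the drift estimate.\<close>

lemma lyap_le:
  assumes "valid_tree ps" "x \<in> vertices ps" "0 \<le> c" "c * (2 * real (length ps) + 2) \<le> 1"
  shows "lyap c ps x \<le> 4 ^ 15 * 4 ^ length ps"
proof -
  define W where "W = weight_sum ps"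
  have W: "0 \<le> W" "W \<le> 2 * 4 ^ length ps"
    using weight_sum_ge[OF assms(1)] weight_sum_le[OF assms(1)] by (auto simp: W_def)
  have "c * depth ps x \<le> c * (2 * real (length ps) + 2)"
    using assms depth_le_length[OF assms(2)] by (intro mult_left_mono) auto
  then have cd: "c * depth ps x \<le> 1" using assms by simp
  have "c * potential ps (weight ps) x \<le> c * (W * depth ps x)"
    using potential_le[OF assms(1), of "weight ps" x] assms
    by (intro mult_left_mono) (auto simp: W_def weight_def)
  also have "\<dots> = (c * depth ps x) * W" by simp
  also have "\<dots> \<le> W" using cd W mult_right_mono[OF cd W(1)] by simp
  finally have g: "c * potential ps (weight ps) x \<le> W" .
  have "W + 4 ^ 13 + G \<le> 4 ^ 15 * X" if "1 \<le> X" "W \<le> 2 * X" "G \<le> W" for G X :: real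
    using that by simp
  from this[of "4 ^ length ps" "c * potential ps (weight ps) x"]
  have "W + 4 ^ 13 + c * potential ps (weight ps) x \<le> 4 ^ 15 * 4 ^ length ps"
    using W g by simp
  moreover have "0 \<le> c * (W / (2 * real (length ps) + 2)) * potential ps (\<lambda>_. 1) x"
    using potential_nonneg[OF assms(1), of "\<lambda>_. 1" x] W assms by simp
  ultimately have num: "W + 4 ^ 13 + c * potential ps (weight ps) x
     - c * (W / (2 * real (length ps) + 2)) * potential ps (\<lambda>_. 1) x \<le> 4 ^ 15 * 4 ^ length ps"
    by linarith
  have "1 \<le> real ((length ps + 13) choose 13)"
    using zero_less_binomial[of 13 "length ps + 13"] by linarith
  then have "4 ^ 15 * 4 ^ length ps / real ((length ps + 13) choose 13) \<le> 4 ^ 15 * 4 ^ length ps / 1"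
    by (intro divide_left_mono) auto
  moreover have "lyap c ps x \<le> 4 ^ 15 * 4 ^ length ps / real ((length ps + 13) choose 13)"
    unfolding lyap_def W_def[symmetric] using num by (intro divide_right_mono) auto
  ultimately show ?thesis by simp
qed

text \<open>Lets the coefficient decrease with time. The term in \<open>g\<close> can only drop,
  while the one in \<open>h\<close> rises by at most
  \<open>c * V * W / (2 * m) \<le> W / (2 * m)\<close>, which is a fraction \<open>1 / m\<close> of
  the functional by \<open>lyap_ge\<close>.\<close>

lemma lyap_change:
  assumes "valid_tree ps" "x \<in> vertices ps" "0 \<le> c'" "c' \<le> c" "c - c' \<le> c / m" "0 < m"
    and small: "c * (2 * real (length ps) + 2) \<le> 1"
  shows "lyap c' ps x \<le> (1 + 1 / m) * lyap c ps x"
proof -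
  define V where "V = 2 * real (length ps) + 2"
  define W where "W = weight_sum ps"
  define B where "B = real ((length ps + 13) choose 13)"
  have V: "V > 0" by (simp add: V_def)
  have W: "0 \<le> W" using weight_sum_ge[OF assms(1)] by (simp add: W_def)
  have B: "B > 0" by (simp add: B_def zero_less_binomial_iff)
  have "c' * potential ps (weight ps) x \<le> c * potential ps (weight ps) x"
    using potential_nonneg[OF assms(1), of "weight ps" x] assms by (intro mult_right_mono) (auto simp: weight_def)
  moreover have "(c - c') * (W / V) * potential ps (\<lambda>_. 1) x \<le> (W / 2) / m"
  proof -
    have "(c - c') * (W / V) * potential ps (\<lambda>_. 1) x \<le> (c / m) * (W / V) * (V * (V / 2))"
    proof (intro mult_mono)
      have "potential ps (\<lambda>_. 1) x \<le> V * depth ps x"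
        using potential_le[OF assms(1), of "\<lambda>_. 1" x] by (simp add: V_def)
      also have "\<dots> \<le> V * (V / 2)"
        using depth_le_length[OF assms(2)] V by (intro mult_left_mono) (auto simp: V_def)
      finally show "potential ps (\<lambda>_. 1) x \<le> V * (V / 2)" .
    qed (use assms W V potential_nonneg[OF assms(1), of "\<lambda>_. 1" x] in auto)
    also have "\<dots> = (c * V) * (W / 2 / m)" using V assms by (simp add: field_simps)
    also have "\<dots> \<le> 1 * (W / 2 / m)"
      using small W assms by (intro mult_right_mono) (auto simp: V_def)
    finally show ?thesis by simp
  qed
  moreover have "(c - c') * (W / V) * potential ps (\<lambda>_. 1) x =
      c * (W / V) * potential ps (\<lambda>_. 1) x - c' * (W / V) * potential ps (\<lambda>_. 1) x"
    by (simp only: left_diff_distrib)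
  ultimately have "W + 4 ^ 13 + c' * potential ps (weight ps) x - c' * (W / V) * potential ps (\<lambda>_. 1) x
      \<le> W + 4 ^ 13 + c * potential ps (weight ps) x - c * (W / V) * potential ps (\<lambda>_. 1) x + (W / 2) / m"
    by linarith
  then have "lyap c' ps x \<le> (W + 4 ^ 13 + c * potential ps (weight ps) x
      - c * (W / V) * potential ps (\<lambda>_. 1) x + (W / 2) / m) / B"
    unfolding lyap_def W_def[symmetric] V_def[symmetric] B_def[symmetric] using B by (intro divide_right_mono) auto
  also have "\<dots> = lyap c ps x + (W / (2 * B)) / m"
    unfolding lyap_def W_def[symmetric] V_def[symmetric] B_def[symmetric] by (simp add: add_divide_distrib)
  also have "(W / (2 * B)) / m \<le> lyap c ps x / m"
  proof (rule divide_right_mono)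
    have "W / (2 * B) \<le> (W + 4 ^ 13) / (2 * B)" using B by (intro divide_right_mono) auto
    also have "\<dots> \<le> lyap c ps x"
      using lyap_ge[OF assms(1,2) _ small] assms by (simp add: W_def B_def)
    finally show "W / (2 * B) \<le> lyap c ps x" .
  qed (use assms in auto)
  finally show ?thesis by (simp add: algebra_simps)
qed

section \<open>Expectations along the process\<close>

lemma expectation_pmf_of_multiset:
  fixes f :: "'a \<Rightarrow> real"
  assumes "M \<noteq> {#}"
  shows "measure_pmf.expectation (pmf_of_multiset M) f = (\<Sum>y\<in>#M. f y) / size M"
proof -
  have eq: "(\<Sum>y\<in>#N. f y) = (\<Sum>y\<in>A. f y * count N y)" if "finite A" "set_mset N \<subseteq> A" for A N
    using that(2)
  proof (induction N)
    case (add y N)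
    have "(\<Sum>z\<in>A. f z * count (add_mset y N) z) = (\<Sum>z\<in>A. f z * count N z + (if z = y then f y else 0))"
      by (intro sum.cong) (auto simp: algebra_simps)
    then show ?case using add that(1) by (simp add: sum.distrib)
  qed simp
  have "measure_pmf.expectation (pmf_of_multiset M) f = (\<Sum>y\<in>set_mset M. f y * (count M y / size M))"
    using assms by (subst integral_measure_pmf_real[of "set_mset M"]) auto
  then show ?thesis
    by (simp add: eq[of "set_mset M" M] sum_divide_distrib)
qed

lemma expectation_mono_pmf_finite:
  fixes f g :: "'a \<Rightarrow> real"
  assumes "finite (set_pmf p)" "\<And>x. x \<in> set_pmf p \<Longrightarrow> f x \<le> g x"
  shows "measure_pmf.expectation p f \<le> measure_pmf.expectation p g"
  using assms by (intro integral_mono_AE integrable_measure_pmf_finite) (auto simp: AE_measure_pmf_iff)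

lemma expectation_bind_pmf_finite:
  fixes h :: "'b \<Rightarrow> real"
  assumes "finite (set_pmf p)" "\<And>x. x \<in> set_pmf p \<Longrightarrow> finite (set_pmf (f x))"
  shows "measure_pmf.expectation (bind_pmf p f) h =
    measure_pmf.expectation p (\<lambda>x. measure_pmf.expectation (f x) h)"
  using assms
  by (subst pmf_expectation_bind[of "set_pmf p"]) (auto simp: integral_measure_pmf[of "set_pmf p"])

lemma edge_ends_not_empty [simp]: "edge_ends ps x \<noteq> {#}"
  using size_edge_ends_pos[of ps x] by auto

lemma edge_ends_subset_vertices:
  assumes "valid_tree ps" "x \<in> vertices ps"
  shows "set_mset (edge_ends ps x) \<subseteq> vertices ps"
proof (cases x)
  case (Suc j)
  then have "j < length ps" using assms(2) by (simp add: vertices_length)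
  moreover from this have "ps ! j \<le> j" using assms(1) by (simp add: valid_tree_def)
  ultimately show ?thesis by (auto simp: edge_ends_def vertices_length Suc)
qed (auto simp: edge_ends_def vertices_length)

section \<open>Transitions with Bernoulli leaves\<close>

lemma tbrw_step_ber_law:
  "tbrw_step (ber_law \<gamma>) n (ps, x) =
    bind_pmf (bernoulli_pmf (real n powr (- \<gamma>)))
      (\<lambda>b. let ps' = if b then ps @ [x] else ps in map_pmf (\<lambda>y. (ps', y)) (pmf_of_multiset (edge_ends ps' x)))"
  by (auto simp: tbrw_step_def ber_law_def bind_map_pmf attach_def srw_step_def Let_def intro!: bind_pmf_cong)

lemma expectation_tbrw_step:
  fixes \<phi> :: "nat list \<times> nat \<Rightarrow> real"
  assumes "real n powr (- \<gamma>) \<le> 1"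
  defines "p \<equiv> real n powr (- \<gamma>)"
  shows "measure_pmf.expectation (tbrw_step (ber_law \<gamma>) n (ps, x)) \<phi> =
    (1 - p) * ((\<Sum>y\<in>#edge_ends ps x. \<phi> (ps, y)) / size (edge_ends ps x))
    + p * ((\<Sum>y\<in>#edge_ends (ps @ [x]) x. \<phi> (ps @ [x], y)) / size (edge_ends (ps @ [x]) x))"
  using assms unfolding tbrw_step_ber_law p_def
  by (subst expectation_bind_pmf_finite)
    (auto simp: Let_def expectation_pmf_of_multiset finite_subset[OF subset_UNIV] algebra_simps)

lemma set_tbrw_step:
  assumes "valid_tree ps" "x \<in> vertices ps" "s \<in> set_pmf (tbrw_step (ber_law \<gamma>) n (ps, x))"
  shows "valid_tree (fst s) \<and> snd s \<in> vertices (fst s) \<and> (fst s = ps \<or> fst s = ps @ [x])"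
proof -
  obtain b y where s: "s = (if b then ps @ [x] else ps, y)" "y \<in># edge_ends (if b then ps @ [x] else ps) x"
    using assms(3) by (auto simp: tbrw_step_ber_law Let_def split: if_splits)
  have "x \<in> vertices (ps @ [x])" using assms(2) by (simp add: vertices_snoc)
  then show ?thesis
    using s assms(1,2) valid_tree_snoc[OF assms(1,2)] edge_ends_subset_vertices[of "ps @ [x]" x]
      edge_ends_subset_vertices[of ps x]
    by (auto split: if_splits)
qed

lemma finite_set_tbrw_step [simp]: "finite (set_pmf (tbrw_step (ber_law \<gamma>) n s))"
  by (cases s) (auto simp: tbrw_step_ber_law Let_def finite_subset[OF subset_UNIV])

lemma finite_set_tbrw [simp]: "finite (set_pmf (tbrw (ber_law \<gamma>) ps x n))"
  by (induction n) auto

lemma set_tbrw: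
  assumes "valid_tree ps" "x \<in> vertices ps" "s \<in> set_pmf (tbrw (ber_law \<gamma>) ps x n)"
  shows "valid_tree (fst s) \<and> snd s \<in> vertices (fst s) \<and> length (fst s) \<le> length ps + n"
  using assms(3)
proof (induction n arbitrary: s)
  case 0
  then show ?case using assms by simp
next
  case (Suc n)
  obtain ps' x' where s': "(ps', x') \<in> set_pmf (tbrw (ber_law \<gamma>) ps x n)"
    "s \<in> set_pmf (tbrw_step (ber_law \<gamma>) (Suc n) (ps', x'))"
    using Suc.prems by auto
  show ?case
    using Suc.IH[OF s'(1)] set_tbrw_step[OF _ _ s'(2)] by auto
qed

section \<open>Exponential moments of the number of edges\<close>

lemma powr_neg_le_1: "0 \<le> \<gamma> \<Longrightarrow> real (Suc n) powr (- \<gamma>) \<le> 1"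
  by (simp add: powr_minus inverse_le_1_iff ge_one_powr_ge_zero)

text \<open>The number of edges grows by a Bernoulli variable whose law does not depend on the tree
  or the walker.\<close>

lemma expectation_power_length_step:
  assumes "0 \<le> \<gamma>"
  shows "measure_pmf.expectation (tbrw_step (ber_law \<gamma>) (Suc n) s) (\<lambda>s. a ^ length (fst s)) =
    (1 + real (Suc n) powr (- \<gamma>) * (a - 1)) * a ^ length (fst s)"
proof -
  obtain ps x where s: "s = (ps, x)" by (cases s)
  show ?thesis
    unfolding s by (subst expectation_tbrw_step[OF powr_neg_le_1[OF assms]])
      (simp add: sum_mset_constant algebra_simps)
qed

text \<open>One increment of the comparison of the sum of \<open>k powr (- \<gamma>)\<close> with
  its integral. With \<open>N = n + 1\<close>, Young's inequality gives \<open>n powr (1 - \<gamma>)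
  * N powr \<gamma> \<le> N - (1 - \<gamma>)\<close>; dividing by \<open>N powr \<gamma>\<close>
  yields the claim, also for \<open>n = 0\<close>.\<close>

lemma sum_powr_step:
  assumes "0 < \<gamma>" "\<gamma> < 1"
  shows "real n powr (1 - \<gamma>) / (1 - \<gamma>) + real (Suc n) powr (- \<gamma>) \<le> real (Suc n) powr (1 - \<gamma>) / (1 - \<gamma>)"
proof -
  define N where "N = real (Suc n)"
  have N: "0 < N" by (simp add: N_def)
  have "real n powr (1 - \<gamma>) * N powr \<gamma> \<le> (1 - \<gamma>) * real n + \<gamma> * N"
    using assms Youngs_inequality_0[of "1 - \<gamma>" \<gamma> "real n" N] by (cases "n = 0") (auto simp: N_def)
  also have "\<dots> = N - (1 - \<gamma>)" by (simp add: N_def algebra_simps)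
  finally have "real n powr (1 - \<gamma>) * N powr \<gamma> * N powr (- \<gamma>) \<le> (N - (1 - \<gamma>)) * N powr (- \<gamma>)"
    by (intro mult_right_mono) auto
  moreover have "real n powr (1 - \<gamma>) * N powr \<gamma> * N powr (- \<gamma>) = real n powr (1 - \<gamma>)"
    using N by (simp add: powr_minus)
  moreover have "(N - (1 - \<gamma>)) * N powr (- \<gamma>) = N powr (1 - \<gamma>) - (1 - \<gamma>) * N powr (- \<gamma>)"
    using N by (simp add: powr_diff powr_minus field_simps)
  ultimately have "real n powr (1 - \<gamma>) + (1 - \<gamma>) * N powr (- \<gamma>) \<le> N powr (1 - \<gamma>)"
    by linarith
  then have "(real n powr (1 - \<gamma>) + (1 - \<gamma>) * N powr (- \<gamma>)) / (1 - \<gamma>) \<le> N powr (1 - \<gamma>) / (1 - \<gamma>)"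
    using assms by (intro divide_right_mono) auto
  then show ?thesis using assms by (simp add: N_def add_divide_distrib)
qed

text \<open>Product of the one-step factors, each bounded by
  \<open>1 + t \<le> exp t\<close>.\<close>

lemma expectation_power_length:
  assumes "0 < \<gamma>" "\<gamma> < 1" "1 \<le> a"
  shows "measure_pmf.expectation (tbrw (ber_law \<gamma>) ps x n) (\<lambda>s. a ^ length (fst s)) \<le>
    a ^ length ps * exp ((a - 1) * (real n powr (1 - \<gamma>) / (1 - \<gamma>)))"
proof (induction n)
  case (Suc n)
  let ?p = "real (Suc n) powr (- \<gamma>)"
  let ?E = "measure_pmf.expectation (tbrw (ber_law \<gamma>) ps x n) (\<lambda>s. a ^ length (fst s))"
  have "measure_pmf.expectation (tbrw (ber_law \<gamma>) ps x (Suc n)) (\<lambda>s. a ^ length (fst s)) = (1 + ?p * (a - 1)) * ?E"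
    unfolding tbrw.simps
    by (subst expectation_bind_pmf_finite) (use assms in \<open>simp_all add: expectation_power_length_step\<close>)
  also have "\<dots> \<le> exp (?p * (a - 1)) * (a ^ length ps * exp ((a - 1) * (real n powr (1 - \<gamma>) / (1 - \<gamma>))))"
    using assms Suc.IH by (intro mult_mono exp_ge_add_one_self integral_nonneg_AE) auto
  also have "\<dots> = a ^ length ps * exp ((a - 1) * (real n powr (1 - \<gamma>) / (1 - \<gamma>) + ?p))"
    by (simp add: algebra_simps flip: exp_add)
  also have "\<dots> \<le> a ^ length ps * exp ((a - 1) * (real (Suc n) powr (1 - \<gamma>) / (1 - \<gamma>)))"
    unfolding exp_le_cancel_iff using sum_powr_step[OF assms(1,2), of n] assms
    by (intro mult_left_mono iffD2[OF exp_le_cancel_iff]) auto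
  finally show ?case .
qed simp

section \<open>Bounds uniform in time from limits\<close>

lemma bounded_of_tendsto_zero:
  fixes f :: "nat \<Rightarrow> real"
  assumes "f \<longlonglongrightarrow> 0"
  obtains C where "0 < C" "\<And>n. f n \<le> C"
proof -
  have "Bseq f" using assms by (intro convergent_imp_Bseq) (auto simp: convergent_def)
  then obtain C where "0 < C" "\<And>n. norm (f n) \<le> C" by (auto simp: Bseq_def)
  then show ?thesis using that[of C] by (metis abs_le_D1 real_norm_def)
qed

text \<open>Here \<gamma> > 1/2 is decisive: as \<open>1 - \<gamma> < \<gamma>\<close>, the decay
  with exponent \<open>n powr \<gamma>\<close> beats the exponential moment of the tree size and any
  power of \<open>n\<close>.\<close>

lemma tail_tendsto:
  fixes A M \<gamma> :: real
  assumes "0 < A" "1/2 < \<gamma>" "\<gamma> < 1"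
  shows "(\<lambda>n. real n powr M * (exp (A * real n powr (1 - \<gamma>)) * 2 powr (- (real n powr \<gamma>)))) \<longlonglongrightarrow> 0"
proof -
  define \<delta> where "\<delta> = 1 - \<gamma>"
  have "0 < \<delta>" "\<delta> < \<gamma>" "0 < \<gamma>" using assms by (auto simp: \<delta>_def)
  then have "(\<lambda>n. real n powr M * exp (A * real n powr \<delta> - ln 2 * real n powr \<gamma>)) \<longlonglongrightarrow> 0"
    using \<open>0 < A\<close> by real_asymp
  then show ?thesis by (simp add: powr_def[of 2] exp_diff exp_minus field_simps \<delta>_def)
qed

lemma poly_tendsto:
  fixes M \<epsilon> :: real
  assumes "0 < \<epsilon>"
  shows "(\<lambda>n. real n powr M * (real n ^ 15 * 2 powr (- (real n powr \<epsilon>)))) \<longlonglongrightarrow> 0"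
  using assms by real_asymp

section \<open>Diameter and depth\<close>

lemma tadj_parent:
  "i < length ps \<Longrightarrow> (Suc i, ps ! i) \<in> tadj ps" "i < length ps \<Longrightarrow> (ps ! i, Suc i) \<in> tadj ps"
  by (auto simp: tadj_def)

lemma relpow_depth:
  assumes "valid_tree ps" "v \<in> vertices ps"
  shows "(v, 0) \<in> tadj ps ^^ depth ps v \<and> (0, v) \<in> tadj ps ^^ depth ps v"
  using assms(2)
proof (induction v rule: less_induct)
  case (less v)
  show ?case
  proof (cases v)
    case (Suc i)
    then have i: "i < length ps" using less.prems by (simp add: vertices_length)
    moreover from this have "ps ! i \<le> i" using assms(1) by (simp add: valid_tree_def)
    ultimately have "(ps ! i, 0) \<in> tadj ps ^^ depth ps (ps ! i) \<and> (0, ps ! i) \<in> tadj ps ^^ depth ps (ps ! i)"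
      using Suc by (intro less.IH) (auto simp: vertices_length)
    then show ?thesis
      using tadj_parent[OF i] by (auto simp: Suc depth_Suc[OF assms(1) i] intro: relpow_Suc_I relpow_Suc_I2
          simp del: relpow.simps)
  qed simp
qed

lemma tdist_le_depth:
  assumes "valid_tree ps" "u \<in> vertices ps" "v \<in> vertices ps"
  shows "tdist ps u v \<le> depth ps u + depth ps v"
proof -
  have "(u, v) \<in> tadj ps ^^ (depth ps u + depth ps v)"
    using relpow_depth[OF assms(1,2)] relpow_depth[OF assms(1,3)] by (auto simp: relpow_add)
  then show ?thesis unfolding tdist_def by (rule Least_le)
qed

text \<open>Take the deeper end of a pair at maximal distance; the route through the root joins the
  pair.\<close>

lemma diam_le_depth:
  assumes "valid_tree ps"
  obtains v where "v \<in> vertices ps" "diam ps \<le> 2 * depth ps v"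
proof -
  let ?D = "{tdist ps u v | u v. u \<in> vertices ps \<and> v \<in> vertices ps}"
  have "?D = (\<lambda>(u, v). tdist ps u v) ` (vertices ps \<times> vertices ps)" by auto
  then have "finite ?D" by (simp add: vertices_def)
  moreover have "tdist ps 0 0 \<in> ?D" by (auto simp: vertices_length)
  ultimately have "diam ps \<in> ?D" unfolding diam_def by (intro Max_in) auto
  then obtain u v where uv: "u \<in> vertices ps" "v \<in> vertices ps" "diam ps = tdist ps u v" by auto
  have "diam ps \<le> depth ps u + depth ps v"
    using tdist_le_depth[OF assms uv(1,2)] uv(3) by simp
  then show ?thesis
    using uv that[of u] that[of v] by linarith
qed

section \<open>Tail bound for the diameter\<close>

text \<open>The coefficient \<open>c = 6 * p\<close> of \<open>lyap_step\<close> for the leaf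
  probability \<open>p\<close> of step \<open>n\<close>.\<close>

definition rate :: "real \<Rightarrow> nat \<Rightarrow> real" where
  "rate \<gamma> n = 6 * real n powr (- \<gamma>)"

text \<open>For \<open>n \<ge> 1\<close> this says
  \<open>48 * (length ps + 1) \<le> n powr \<gamma>\<close>, which fails only for trees far larger
  than their typical order \<open>n powr (1 - \<gamma>)\<close>.\<close>

definition small_tree :: "real \<Rightarrow> nat \<Rightarrow> nat list \<Rightarrow> bool" where
  "small_tree \<gamma> n ps \<longleftrightarrow> rate \<gamma> n * (2 * real (length ps) + 2) \<le> 1/4"

text \<open>Cutting off at large trees keeps the functional nonnegative.\<close>

definition cut_lyap :: "real \<Rightarrow> nat \<Rightarrow> nat list \<times> nat \<Rightarrow> real" where
  "cut_lyap \<gamma> n s = (if small_tree \<gamma> n (fst s) then lyap (rate \<gamma> n) (fst s) (snd s) else 0)"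

lemma rate_nonneg: "0 \<le> rate \<gamma> n"
  by (simp add: rate_def)

lemma rate_Suc_le:
  assumes "0 \<le> \<gamma>" "1 \<le> n"
  shows "rate \<gamma> (Suc n) \<le> rate \<gamma> n"
  using assms by (auto simp: rate_def intro!: powr_mono2')

text \<open>From \<open>n / (n + 1) \<le> (n / (n + 1)) powr \<gamma>\<close>, valid as \<gamma>
  \<le> 1. This is the hypothesis of \<open>lyap_change\<close> with
  \<open>m = n + 1\<close>.\<close>

lemma rate_diff_le:
  assumes "0 \<le> \<gamma>" "\<gamma> \<le> 1" "1 \<le> n"
  shows "rate \<gamma> n - rate \<gamma> (Suc n) \<le> rate \<gamma> n / real (Suc n)"
proof -
  have "(real n / real (Suc n)) powr 1 \<le> (real n / real (Suc n)) powr \<gamma>"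
    using assms by (intro powr_mono') auto
  then have "real n / real (Suc n) \<le> real n powr \<gamma> / real (Suc n) powr \<gamma>"
    using assms by (simp add: powr_divide del: of_nat_Suc)
  then have "real n powr (- \<gamma>) * (real n / real (Suc n)) \<le> real n powr (- \<gamma>) * (real n powr \<gamma> / real (Suc n) powr \<gamma>)"
    by (intro mult_left_mono) auto
  also have "\<dots> = real (Suc n) powr (- \<gamma>)"
    using assms by (simp add: powr_minus field_simps del: of_nat_Suc)
  finally have "real n powr (- \<gamma>) * (1 - 1 / real (Suc n)) \<le> real (Suc n) powr (- \<gamma>)"
    by (simp add: field_simps)
  then show ?thesis by (simp add: rate_def algebra_simps)
qed

lemma small_tree_le_one:
  "small_tree \<gamma> n ps \<Longrightarrow> rate \<gamma> n * (2 * real (length ps) + 2) \<le> 1"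
  by (simp add: small_tree_def)

lemma cut_lyap_nonneg:
  assumes "valid_tree (fst s)" "snd s \<in> vertices (fst s)"
  shows "0 \<le> cut_lyap \<gamma> n s"
proof (cases "small_tree \<gamma> n (fst s)")
  case True
  have "0 \<le> (weight_sum (fst s) + 4 ^ 13) / (2 * real ((length (fst s) + 13) choose 13))"
    using weight_sum_ge[OF assms(1)] by simp
  also have "\<dots> \<le> lyap (rate \<gamma> n) (fst s) (snd s)"
    using lyap_ge[OF assms rate_nonneg small_tree_le_one[OF True]] .
  finally show ?thesis by (simp add: cut_lyap_def)
qed (simp add: cut_lyap_def)

lemma cut_lyap_le:
  assumes "valid_tree (fst s)" "snd s \<in> vertices (fst s)"
  shows "cut_lyap \<gamma> n s \<le> 4 ^ 15 * 4 ^ length (fst s)"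
  using lyap_le[OF assms rate_nonneg small_tree_le_one] by (simp add: cut_lyap_def)

text \<open>Exponential Markov bound in pointwise form: the exponent
  \<open>48 * (length ps + 1) - n powr \<gamma>\<close> of 2 is positive on the exceptional
  event.\<close>

lemma not_small_tree:
  assumes "\<not> small_tree \<gamma> n ps" "1 \<le> n"
  shows "1 \<le> 2 ^ 48 * (2 ^ 48) ^ length ps * 2 powr (- (real n powr \<gamma>))"
proof -
  have "1 < 48 * (real (length ps) + 1) * real n powr (- \<gamma>)"
    using assms by (simp add: small_tree_def rate_def algebra_simps)
  then have "real n powr \<gamma> < 48 * (real (length ps) + 1)"
    using assms(2) by (simp add: powr_minus field_simps)
  then have "0 \<le> real (48 + 48 * length ps) + - (real n powr \<gamma>)" by simp
  then have "1 \<le> (2::real) powr (real (48 + 48 * length ps) + - (real n powr \<gamma>))"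
    by (intro ge_one_powr_ge_zero) auto
  also have "\<dots> = 2 ^ (48 + 48 * length ps) * 2 powr (- (real n powr \<gamma>))"
    unfolding powr_add using powr_realpow[of 2 "48 + 48 * length ps"] by simp
  also have "(2::real) ^ (48 + 48 * length ps) = 2 ^ 48 * (2 ^ 48) ^ length ps"
    by (simp only: power_add power_mult)
  finally show ?thesis .
qed

text \<open>From a small tree, \<open>lyap_step\<close> applies at the new rate and
  \<open>lyap_change\<close> returns to the old one. From a large tree the next value is at most
  \<open>4 ^ 16 * 4 ^ length ps\<close>; multiplying by the bound of \<open>not_small_tree\<close>
  produces \<open>2 ^ 80 = 4 ^ 16 * 2 ^ 48\<close> and \<open>2 ^ 50 = 4 * 2 ^ 48\<close>.\<close>

lemma cut_lyap_step:
  assumes \<gamma>: "0 \<le> \<gamma>" "\<gamma> \<le> 1" and n: "1 \<le> n"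
    and s: "valid_tree (fst s)" "snd s \<in> vertices (fst s)"
  shows "measure_pmf.expectation (tbrw_step (ber_law \<gamma>) (Suc n) s) (cut_lyap \<gamma> (Suc n))
    \<le> (1 + 1 / real (Suc n)) * cut_lyap \<gamma> n s
      + 2 ^ 80 * ((2 ^ 50) ^ length (fst s) * 2 powr (- (real n powr \<gamma>)))"
proof -
  obtain ps x where ps: "s = (ps, x)" by (cases s)
  have valid: "valid_tree ps" "x \<in> vertices ps" using s by (auto simp: ps)
  let ?step = "tbrw_step (ber_law \<gamma>) (Suc n) s"
  let ?c = "rate \<gamma> (Suc n)"
  have c: "0 \<le> ?c" "?c \<le> rate \<gamma> n"
    using rate_nonneg rate_Suc_le[OF \<gamma>(1) n] by auto
  show ?thesis
  proof (cases "small_tree \<gamma> n ps")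
    case True
    have small: "?c * (2 * real (length ps) + 2) \<le> 1/4"
    proof -
      have "?c * (2 * real (length ps) + 2) \<le> rate \<gamma> n * (2 * real (length ps) + 2)"
        using c by (intro mult_right_mono) auto
      then show ?thesis using True unfolding small_tree_def by linarith
    qed
    have "measure_pmf.expectation ?step (cut_lyap \<gamma> (Suc n)) \<le>
        measure_pmf.expectation ?step (\<lambda>s. lyap ?c (fst s) (snd s))"
    proof (rule expectation_mono_pmf_finite)
      fix t assume "t \<in> set_pmf ?step"
      then have t: "valid_tree (fst t)" "snd t \<in> vertices (fst t)" "length (fst t) \<le> Suc (length ps)"
        using set_tbrw_step[OF valid] unfolding ps by fastforce+
      \<comment> \<open>One leaf at most doubles the total degree, so the functional is still
        nonnegative and the cut-off only lowers it.\<close>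
      have "?c * (2 * real (length (fst t)) + 2) \<le> ?c * (2 * (2 * real (length ps) + 2))"
        using t(3) c by (intro mult_left_mono) auto
      also have "\<dots> = 2 * (?c * (2 * real (length ps) + 2))" by (simp only: mult_ac)
      also have "\<dots> \<le> 1" using small by linarith
      finally have "(weight_sum (fst t) + 4 ^ 13) / (2 * real ((length (fst t) + 13) choose 13))
          \<le> lyap ?c (fst t) (snd t)"
        by (rule lyap_ge[OF t(1,2) c(1)])
      moreover have "0 \<le> (weight_sum (fst t) + 4 ^ 13) / (2 * real ((length (fst t) + 13) choose 13))"
        using weight_sum_ge[OF t(1)] by simp
      ultimately show "cut_lyap \<gamma> (Suc n) t \<le> lyap ?c (fst t) (snd t)"
        by (simp add: cut_lyap_def)
    qed simp
    \<comment> \<open>The leaf probability of this step is \<open>Suc n powr (- \<gamma>)\<close>,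
      so \<open>?c\<close> is exactly six times it.\<close>
    also have "\<dots> \<le> lyap ?c ps x"
      unfolding ps expectation_tbrw_step[OF powr_neg_le_1[OF \<gamma>(1)]] fst_conv snd_conv
      using lyap_step[OF valid _ _ _ small] powr_neg_le_1[OF \<gamma>(1), of n] by (simp add: rate_def)
    also have "\<dots> \<le> (1 + 1 / real (Suc n)) * lyap (rate \<gamma> n) ps x"
      using rate_diff_le[OF \<gamma> n] c small_tree_le_one[OF True] by (intro lyap_change[OF valid]) auto
    also have "\<dots> = (1 + 1 / real (Suc n)) * cut_lyap \<gamma> n s"
      using True by (simp add: cut_lyap_def ps)
    also have "\<dots> \<le> (1 + 1 / real (Suc n)) * cut_lyap \<gamma> n s
      + 2 ^ 80 * ((2 ^ 50) ^ length (fst s) * 2 powr (- (real n powr \<gamma>)))"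
      by simp
    finally show ?thesis .
  next
    case False
    have "measure_pmf.expectation ?step (cut_lyap \<gamma> (Suc n)) \<le>
        measure_pmf.expectation ?step (\<lambda>_. 4 ^ 15 * 4 ^ Suc (length ps))"
    proof (rule expectation_mono_pmf_finite)
      fix t assume "t \<in> set_pmf ?step"
      then have t: "valid_tree (fst t)" "snd t \<in> vertices (fst t)" "length (fst t) \<le> Suc (length ps)"
        using set_tbrw_step[OF valid] unfolding ps by fastforce+
      have "cut_lyap \<gamma> (Suc n) t \<le> 4 ^ 15 * 4 ^ length (fst t)"
        by (rule cut_lyap_le[OF t(1,2)])
      also have "\<dots> \<le> 4 ^ 15 * 4 ^ Suc (length ps)"
        using t(3) by (intro mult_left_mono power_increasing) auto
      finally show "cut_lyap \<gamma> (Suc n) t \<le> 4 ^ 15 * 4 ^ Suc (length ps)" .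
    qed simp
    also have "\<dots> = 4 ^ 16 * 4 ^ length ps * 1" by simp
    also have "\<dots> \<le> 4 ^ 16 * 4 ^ length ps * (2 ^ 48 * (2 ^ 48) ^ length ps * 2 powr (- (real n powr \<gamma>)))"
      using not_small_tree[OF False n] by (intro mult_left_mono) auto
    also have "\<dots> = 2 ^ 80 * ((2 ^ 50) ^ length ps * 2 powr (- (real n powr \<gamma>)))"
    proof -
      have "(2 ^ 50 :: real) ^ length ps = 4 ^ length ps * (2 ^ 48) ^ length ps"
        by (simp flip: power_mult_distrib)
      then show ?thesis by simp
    qed
    finally show ?thesis using False by (simp add: ps cut_lyap_def)
  qed
qed

text \<open>Weighs the exponential moment of the tree size against the decay from
  \<open>not_small_tree\<close>. The case \<open>M = 0\<close> bounds the error in each step of the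
  recursion, the general case the probability of a large tree.\<close>

lemma expectation_tail_bound:
  assumes "1/2 < \<gamma>" "\<gamma> < 1"
  obtains C where "0 < C"
    "\<And>n ps x. 1 \<le> n \<Longrightarrow> real n powr M * (measure_pmf.expectation (tbrw (ber_law \<gamma>) ps x n)
        (\<lambda>s. (2 ^ 50) ^ length (fst s)) * 2 powr (- (real n powr \<gamma>))) \<le> C * (2 ^ 50) ^ length ps"
proof -
  define A where "A = (2 ^ 50 - 1) / (1 - \<gamma>)"
  have "0 < A" using assms by (simp add: A_def)
  from bounded_of_tendsto_zero[OF tail_tendsto[OF this assms]]
  obtain C where C: "0 < C"
    "\<And>n. real n powr M * (exp (A * real n powr (1 - \<gamma>)) * 2 powr (- (real n powr \<gamma>))) \<le> C" by blast
  have "real n powr M * (measure_pmf.expectation (tbrw (ber_law \<gamma>) ps x n)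
        (\<lambda>s. (2 ^ 50) ^ length (fst s)) * 2 powr (- (real n powr \<gamma>))) \<le> C * (2 ^ 50) ^ length ps"
    (is "_ * (?E * _) \<le> _") if "1 \<le> n" for n ps x
  proof -
    have "?E \<le> (2 ^ 50) ^ length ps * exp (A * real n powr (1 - \<gamma>))"
      using expectation_power_length[of \<gamma> "2 ^ 50" ps x n] assms by (simp add: A_def)
    then have "real n powr M * (?E * 2 powr (- (real n powr \<gamma>))) \<le> real n powr M *
        (((2 ^ 50) ^ length ps * exp (A * real n powr (1 - \<gamma>))) * 2 powr (- (real n powr \<gamma>)))"
      by (intro mult_left_mono mult_right_mono) auto
    also have "\<dots> = (2 ^ 50) ^ length ps *
        (real n powr M * (exp (A * real n powr (1 - \<gamma>)) * 2 powr (- (real n powr \<gamma>))))"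
      by (simp only: mult_ac)
    also have "\<dots> \<le> (2 ^ 50) ^ length ps * C"
      using C(2) by (intro mult_left_mono) auto
    finally show ?thesis by (simp only: mult.commute)
  qed
  then show ?thesis using that C(1) by blast
qed

text \<open>By \<open>cut_lyap_step\<close> the expectations satisfy
  \<open>e (n + 1) \<le> (1 + 1 / (n + 1)) * e n + K\<close>, so they grow at most like
  \<open>K * n ^ 2\<close>.\<close>

lemma expectation_cut_lyap:
  assumes "1/2 < \<gamma>" "\<gamma> < 1"
  obtains D where "0 < D"
    "\<And>n ps x. valid_tree ps \<Longrightarrow> x \<in> vertices ps \<Longrightarrow> 1 \<le> n \<Longrightarrow>
      measure_pmf.expectation (tbrw (ber_law \<gamma>) ps x n) (cut_lyap \<gamma> n) \<le> D * (2 ^ 50) ^ length ps * real n ^ 2"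
proof -
  obtain C where C: "0 < C"
    "\<And>n ps x. 1 \<le> n \<Longrightarrow> real n powr 0 * (measure_pmf.expectation (tbrw (ber_law \<gamma>) ps x n)
        (\<lambda>s. (2 ^ 50) ^ length (fst s)) * 2 powr (- (real n powr \<gamma>))) \<le> C * (2 ^ 50) ^ length ps"
    using expectation_tail_bound[OF assms, of 0] by blast
  define D where "D = 2 ^ 80 * C"
  have "measure_pmf.expectation (tbrw (ber_law \<gamma>) ps x n) (cut_lyap \<gamma> n) \<le> D * (2 ^ 50) ^ length ps * real n ^ 2"
    if valid: "valid_tree ps" "x \<in> vertices ps" and "1 \<le> n" for n ps x
    using \<open>1 \<le> n\<close>
  proof (induction n rule: dec_induct)
    case base
    \<comment> \<open>At time 1 the rate is 6 and no tree is small. Starting at 1 avoids time 0,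
      where the convention \<open>0 powr a = 0\<close> would make the rate vanish.\<close>
    have "cut_lyap \<gamma> 1 = (\<lambda>_. 0)"
      by (auto simp: cut_lyap_def small_tree_def rate_def)
    then show ?case using C(1) by (simp add: D_def)
  next
    case (step n)
    let ?p = "tbrw (ber_law \<gamma>) ps x n"
    let ?L = "\<lambda>s. (2 ^ 50) ^ length (fst s) :: real"
    define K where "K = D * (2 ^ 50) ^ length ps"
    have K: "0 \<le> K" using C(1) by (simp add: K_def D_def)
    have "measure_pmf.expectation (tbrw (ber_law \<gamma>) ps x (Suc n)) (cut_lyap \<gamma> (Suc n)) =
        measure_pmf.expectation ?p (\<lambda>s. measure_pmf.expectation (tbrw_step (ber_law \<gamma>) (Suc n) s) (cut_lyap \<gamma> (Suc n)))"
      unfolding tbrw.simps by (rule expectation_bind_pmf_finite) simp_all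
    also have "\<dots> \<le> measure_pmf.expectation ?p
        (\<lambda>s. (1 + 1 / real (Suc n)) * cut_lyap \<gamma> n s + 2 ^ 80 * (?L s * 2 powr (- (real n powr \<gamma>))))"
      using step.hyps assms set_tbrw[OF valid]
      by (intro expectation_mono_pmf_finite cut_lyap_step) auto
    also have "\<dots> = (1 + 1 / real (Suc n)) * measure_pmf.expectation ?p (cut_lyap \<gamma> n)
        + 2 ^ 80 * (measure_pmf.expectation ?p ?L * 2 powr (- (real n powr \<gamma>)))"
      by (simp add: integrable_measure_pmf_finite)
    also have "\<dots> \<le> (1 + 1 / real (Suc n)) * (K * real n ^ 2) + K"
    proof (rule add_mono)
      show "(1 + 1 / real (Suc n)) * measure_pmf.expectation ?p (cut_lyap \<gamma> n) \<le> (1 + 1 / real (Suc n)) * (K * real n ^ 2)"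
        using step.IH by (intro mult_left_mono) (auto simp: K_def)
      have "measure_pmf.expectation ?p ?L * 2 powr (- (real n powr \<gamma>)) \<le> C * (2 ^ 50) ^ length ps"
        using C(2)[of n ps x] step.hyps by simp
      then show "2 ^ 80 * (measure_pmf.expectation ?p ?L * 2 powr (- (real n powr \<gamma>))) \<le> K"
        by (simp add: K_def D_def)
    qed
    also have "\<dots> = K * ((1 + 1 / real (Suc n)) * real n ^ 2 + 1)" by (simp add: algebra_simps)
    \<comment> \<open>The bracket is at most \<open>n ^ 2 + n + 1\<close>.\<close>
    also have "\<dots> \<le> K * real (Suc n) ^ 2"
    proof (intro mult_left_mono K)
      have "real n ^ 2 / real (Suc n) \<le> real n"
        by (simp add: field_simps power2_eq_square)
      then show "(1 + 1 / real (Suc n)) * real n ^ 2 + 1 \<le> real (Suc n) ^ 2"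
        by (simp add: algebra_simps power2_eq_square)
    qed
    finally show ?case by (simp add: K_def)
  qed
  then show ?thesis using that[of D] C(1) by (simp add: D_def)
qed

text \<open>A diameter of at least \<open>2 * a\<close> forces a vertex of depth at least
  \<open>a\<close>, whose weight alone is \<open>2 powr a\<close>; the normalisation costs a
  polynomial factor of degree 13.\<close>

lemma cut_lyap_ge_of_diam:
  assumes s: "valid_tree ps" "x \<in> vertices ps" and "small_tree \<gamma> n ps"
    and "2 * a \<le> real (diam ps)" and "length ps \<le> N"
  shows "2 powr a \<le> 2 * real (N + 13) ^ 13 * cut_lyap \<gamma> n (ps, x)"
proof -
  obtain v where v: "v \<in> vertices ps" "diam ps \<le> 2 * depth ps v"
    using diam_le_depth[OF s(1)] .
  have "2 powr a \<le> 2 powr real (depth ps v)"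
    using assms(4) v(2) by (intro powr_mono) auto
  also have "\<dots> = weight ps v" by (simp add: weight_def powr_realpow)
  also have "\<dots> \<le> weight_sum ps" by (rule weight_le_weight_sum[OF v(1)])
  finally have le: "2 powr a \<le> weight_sum ps" .
  define B where "B = real ((length ps + 13) choose 13)"
  have B: "0 < B" by (simp add: B_def zero_less_binomial_iff)
  have "(length ps + 13) choose 13 \<le> (length ps + 13) ^ 13" by (rule binomial_le_pow) simp
  then have "B \<le> real ((length ps + 13) ^ 13)" unfolding B_def of_nat_le_iff .
  also have "\<dots> \<le> real (N + 13) ^ 13"
    unfolding of_nat_power using assms(5) by (intro power_mono) auto
  finally have BN: "B \<le> real (N + 13) ^ 13" .
  have "weight_sum ps / (2 * B) \<le> (weight_sum ps + 4 ^ 13) / (2 * B)"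
    using B by (intro divide_right_mono) auto
  also have "\<dots> \<le> cut_lyap \<gamma> n (ps, x)"
    using lyap_ge[OF s rate_nonneg small_tree_le_one[OF assms(3)]] assms(3)
    by (simp add: cut_lyap_def B_def)
  finally have "weight_sum ps \<le> 2 * B * cut_lyap \<gamma> n (ps, x)"
    using B by (simp add: field_simps)
  also have "\<dots> \<le> 2 * real (N + 13) ^ 13 * cut_lyap \<gamma> n (ps, x)"
    using BN cut_lyap_nonneg[of "(ps, x)" \<gamma> n] s by (intro mult_right_mono) auto
  finally show ?thesis using le by simp
qed

text \<open>The indicator of the event is bounded pointwise: by \<open>not_small_tree\<close> on
  large trees, and by Markov's inequality for \<open>cut_lyap\<close> on small ones.\<close>

lemma diam_tail:
  assumes "valid_tree ps" "x \<in> vertices ps" "1 \<le> n"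
  shows "measure_pmf.prob (tbrw (ber_law \<gamma>) ps x n) {s. real (diam (fst s)) \<ge> 2 * a} \<le>
    2 ^ 48 * (measure_pmf.expectation (tbrw (ber_law \<gamma>) ps x n) (\<lambda>s. (2 ^ 50) ^ length (fst s))
      * 2 powr (- (real n powr \<gamma>)))
    + 2 * real (length ps + n + 13) ^ 13 * 2 powr (- a)
      * measure_pmf.expectation (tbrw (ber_law \<gamma>) ps x n) (cut_lyap \<gamma> n)"
proof -
  let ?p = "tbrw (ber_law \<gamma>) ps x n"
  let ?S = "{s. real (diam (fst s)) \<ge> 2 * a}"
  let ?L = "\<lambda>s. (2 ^ 50) ^ length (fst s) :: real"
  let ?K = "2 * real (length ps + n + 13) ^ 13 * 2 powr (- a)"
  have "measure_pmf.prob ?p ?S = measure_pmf.expectation ?p (indicator ?S)" by simp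
  also have "\<dots> \<le> measure_pmf.expectation ?p
      (\<lambda>s. 2 ^ 48 * (?L s * 2 powr (- (real n powr \<gamma>))) + ?K * cut_lyap \<gamma> n s)"
  proof (rule expectation_mono_pmf_finite)
    fix s assume "s \<in> set_pmf ?p"
    then have s: "valid_tree (fst s)" "snd s \<in> vertices (fst s)" "length (fst s) \<le> length ps + n"
      using set_tbrw[OF assms(1,2)] by auto
    have nn: "0 \<le> ?K * cut_lyap \<gamma> n s"
      using cut_lyap_nonneg[OF s(1,2)] by simp
    have nn': "0 \<le> 2 ^ 48 * (?L s * 2 powr (- (real n powr \<gamma>)))" by simp
    consider "s \<notin> ?S" | "\<not> small_tree \<gamma> n (fst s)" | "s \<in> ?S" "small_tree \<gamma> n (fst s)" by blast
    then show "indicator ?S s \<le> 2 ^ 48 * (?L s * 2 powr (- (real n powr \<gamma>))) + ?K * cut_lyap \<gamma> n s"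
    proof cases
      case 1
      then show ?thesis using nn nn' by simp
    next
      case 2
      have "1 \<le> 2 ^ 48 * ((2 ^ 48) ^ length (fst s) * 2 powr (- (real n powr \<gamma>)))"
        using not_small_tree[OF 2 assms(3)] by (simp only: mult.assoc)
      also have "\<dots> \<le> 2 ^ 48 * (?L s * 2 powr (- (real n powr \<gamma>)))"
        by (intro mult_left_mono mult_right_mono power_mono) auto
      moreover have "indicator ?S s \<le> (1::real)" by (simp add: indicator_def)
      ultimately show ?thesis using nn by linarith
    next
      case 3
      have "2 powr a \<le> 2 * real (length ps + n + 13) ^ 13 * cut_lyap \<gamma> n (fst s, snd s)"
        using 3 by (intro cut_lyap_ge_of_diam s) auto
      then have "2 powr a * 2 powr (- a) \<le>
          2 * real (length ps + n + 13) ^ 13 * cut_lyap \<gamma> n s * 2 powr (- a)"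
        by (intro mult_right_mono) auto
      also have "2 powr a * 2 powr (- a) = (1::real)" by (simp add: powr_minus)
      finally have "1 \<le> ?K * cut_lyap \<gamma> n s" by (simp only: mult_ac)
      moreover have "indicator ?S s \<le> (1::real)" by (simp add: indicator_def)
      ultimately show ?thesis using nn' by linarith
    qed
  qed simp
  also have "\<dots> = 2 ^ 48 * (measure_pmf.expectation ?p ?L * 2 powr (- (real n powr \<gamma>)))
      + ?K * measure_pmf.expectation ?p (cut_lyap \<gamma> n)"
    by (simp add: integrable_measure_pmf_finite)
  finally show ?thesis .
qed

theorem theorem4p1:
  fixes \<gamma> \<epsilon> M :: real
  assumes "1/2 < \<gamma>" and "\<gamma> < 1" and "\<epsilon> > 0" and "M > 0"
  shows "\<forall>k::nat. \<exists>C C'::real. C > 0 \<and> C' > 0 \<and>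
    (\<forall>ps x. valid_tree ps \<longrightarrow> tsize ps = k \<longrightarrow> x \<in> vertices ps \<longrightarrow>
      (\<forall>n::nat. n \<ge> 1 \<longrightarrow>
        measure_pmf.prob (tbrw (ber_law \<gamma>) ps x n)
          {s. real (diam (fst s)) \<ge> C * real n powr \<epsilon>}
        \<le> C' / real n powr M))"
proof
  fix k :: nat
  obtain C where C: "0 < C"
    "\<And>n ps x. 1 \<le> n \<Longrightarrow> real n powr M * (measure_pmf.expectation (tbrw (ber_law \<gamma>) ps x n)
        (\<lambda>s. (2 ^ 50) ^ length (fst s)) * 2 powr (- (real n powr \<gamma>))) \<le> C * (2 ^ 50) ^ length ps"
    using expectation_tail_bound[OF assms(1,2), of M] by blast
  obtain D where D: "0 < D"
    "\<And>n ps x. valid_tree ps \<Longrightarrow> x \<in> vertices ps \<Longrightarrow> 1 \<le> n \<Longrightarrow>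
      measure_pmf.expectation (tbrw (ber_law \<gamma>) ps x n) (cut_lyap \<gamma> n) \<le> D * (2 ^ 50) ^ length ps * real n ^ 2"
    using expectation_cut_lyap[OF assms(1,2)] by blast
  obtain E where E: "0 < E" "\<And>n. real n powr M * (real n ^ 15 * 2 powr (- (real n powr \<epsilon>))) \<le> E"
    using bounded_of_tendsto_zero[OF poly_tendsto[OF assms(3)]] by blast
  \<comment> \<open>\<open>C1\<close> accounts for the trees that are too large, \<open>C2\<close>
    for the polynomial losses in the Markov bound.\<close>
  define C1 where "C1 = 2 ^ 48 * C * (2 ^ 50) ^ k"
  define C2 where "C2 = 2 * (real k + 14) ^ 13 * D * (2 ^ 50) ^ k"
  have pos: "0 < C1" "0 < C2" using C(1) D(1) by (auto simp: C1_def C2_def)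
  \<comment> \<open>The factor 2 is that between diameter and depth; \<open>diam_tail\<close> is
    used with \<open>a = n powr \<epsilon>\<close>.\<close>
  have "measure_pmf.prob (tbrw (ber_law \<gamma>) ps x n) {s. real (diam (fst s)) \<ge> 2 * real n powr \<epsilon>}
      \<le> (C1 + C2 * E) / real n powr M"
    if ps: "valid_tree ps" "tsize ps = k" "x \<in> vertices ps" and n: "1 \<le> n" for ps x n
  proof -
    let ?P = "measure_pmf.prob (tbrw (ber_law \<gamma>) ps x n) {s. real (diam (fst s)) \<ge> 2 * real n powr \<epsilon>}"
    let ?E = "measure_pmf.expectation (tbrw (ber_law \<gamma>) ps x n) (\<lambda>s. (2 ^ 50) ^ length (fst s))"
    let ?F = "measure_pmf.expectation (tbrw (ber_law \<gamma>) ps x n) (cut_lyap \<gamma> n)"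
    let ?t = "2 powr (- (real n powr \<epsilon>))"
    have len: "length ps \<le> k" using ps(2) by (simp add: tsize_def)
    have L: "(2 ^ 50 :: real) ^ length ps \<le> (2 ^ 50) ^ k"
      using len by (intro power_increasing) auto
    have "real (length ps + n + 13) \<le> (real k + 14) * real n"
    proof -
      have "real k * 1 \<le> real k * real n" using n by (intro mult_left_mono) auto
      moreover have "real (length ps) \<le> real k" "1 \<le> real n" using len n by auto
      ultimately show ?thesis unfolding of_nat_add distrib_right by linarith
    qed
    then have N: "real (length ps + n + 13) ^ 13 \<le> (real k + 14) ^ 13 * real n ^ 13"
      unfolding power_mult_distrib[symmetric] by (intro power_mono) auto
    have "?F \<le> D * (2 ^ 50) ^ length ps * real n ^ 2"
      using D(2)[OF ps(1,3) n] .
    also have "\<dots> \<le> D * (2 ^ 50) ^ k * real n ^ 2"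
      using L D(1) by (intro mult_right_mono mult_left_mono) auto
    finally have F: "?F \<le> D * (2 ^ 50) ^ k * real n ^ 2" .
    have "2 * real (length ps + n + 13) ^ 13 * ?t * ?F
        \<le> 2 * real (length ps + n + 13) ^ 13 * ?t * (D * (2 ^ 50) ^ k * real n ^ 2)"
      using F by (intro mult_left_mono) auto
    also have "\<dots> \<le> 2 * ((real k + 14) ^ 13 * real n ^ 13) * ?t * (D * (2 ^ 50) ^ k * real n ^ 2)"
      using N D(1) by (intro mult_right_mono mult_left_mono) auto
    also have "\<dots> = C2 * (real n ^ 15 * ?t)"
    proof -
      \<comment> \<open>The power 13 comes from the binomial normalisation, the power 2 from the
        growth of the expectation.\<close>
      have "real n ^ 15 = real n ^ 13 * real n ^ 2" by (simp flip: power_add)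
      then show ?thesis by (simp add: C2_def)
    qed
    finally have "?P \<le> 2 ^ 48 * (?E * 2 powr (- (real n powr \<gamma>))) + C2 * (real n ^ 15 * ?t)"
      using diam_tail[OF ps(1,3) n, of \<gamma> "real n powr \<epsilon>"] by linarith
    then have "real n powr M * ?P \<le>
        real n powr M * (2 ^ 48 * (?E * 2 powr (- (real n powr \<gamma>))) + C2 * (real n ^ 15 * ?t))"
      by (intro mult_left_mono) auto
    also have "\<dots> = 2 ^ 48 * (real n powr M * (?E * 2 powr (- (real n powr \<gamma>))))
        + C2 * (real n powr M * (real n ^ 15 * ?t))"
      by (simp only: distrib_left mult.left_commute[of "real n powr M"])
    also have "\<dots> \<le> 2 ^ 48 * (C * (2 ^ 50) ^ length ps) + C2 * E"
      using C(2)[OF n, of ps x] E(2)[of n] pos by (intro add_mono mult_left_mono) auto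
    also have "\<dots> \<le> C1 + C2 * E"
    proof -
      have "C * (2 ^ 50) ^ length ps \<le> C * (2 ^ 50) ^ k" using L C(1) by (intro mult_left_mono) auto
      then show ?thesis by (simp add: C1_def)
    qed
    finally show ?thesis using n by (simp add: field_simps)
  qed
  moreover have "0 < C1 + C2 * E" using pos E(1) by (simp add: add_pos_pos)
  ultimately show "\<exists>C C'::real. C > 0 \<and> C' > 0 \<and>
    (\<forall>ps x. valid_tree ps \<longrightarrow> tsize ps = k \<longrightarrow> x \<in> vertices ps \<longrightarrow>
      (\<forall>n::nat. n \<ge> 1 \<longrightarrow>
        measure_pmf.prob (tbrw (ber_law \<gamma>) ps x n)
          {s. real (diam (fst s)) \<ge> C * real n powr \<epsilon>}
        \<le> C' / real n powr M))"
    by (intro exI[of _ 2] exI[of _ "C1 + C2 * E"]) auto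
qed

end
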